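(* There is a randomized $\tilde{O}(m\sqrt n)$ time algorithm that, given an undirected unweighted graph $G=(V,E)$ with $n$ vertices and $m$ edges and sets $S,T\subseteq V$, outputs for each $v\in S$ an estimate $\varepsilon'_{ST}(v)$ such that, with high probability, for every $v\in S$: $\varepsilon_{ST}(v)/2-5/2\le\varepsilon'_{ST}(v)\le\varepsilon_{ST}(v)$, and if $\varepsilon_{ST}(v)$ is divisible by $2$ then $\varepsilon_{ST}(v)/2-2\le\varepsilon'_{ST}(v)\le\varepsilon_{ST}(v)$.
   Context: $d(u,v)$ denotes the shortest path distance in $G$. For $v\in S$, the $ST$-Eccentricity is $\varepsilon_{ST}(v)=\max_{u\in T}d(v,u)$. "With high probability" means with probability at least $1-1/n^c$ for every constant $c$. $\tilde{O}$ hides polylogarithmic factors.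
   Formalization: The running time is taken as Õ(m√n + n): for graphs with very few edges (e.g. m = 0) the literal Õ(m√n) is less than the time needed to output the estimates; when m ≥ √n, e.g. for connected graphs with n ≥ 2, the two bounds agree. *)

theory Defs
  imports "HOL-Probability.Probability"
begin

section \<open>Distances and $ST$-eccentricities\<close>

text \<open>
  An undirected graph on the vertex set \<open>{..<n}\<close> is given by its set of edges, an edge being a
  two-element set of vertices.
\<close>

definition simple_graph :: "nat \<Rightarrow> nat set set \<Rightarrow> bool" where
  "simple_graph n E \<longleftrightarrow> E \<subseteq> {{u, v} | u v. u < n \<and> v < n \<and> u \<noteq> v}"

definition walk :: "'a set set \<Rightarrow> 'a \<Rightarrow> 'a list \<Rightarrow> 'a \<Rightarrow> bool" where
  "walk E u p v \<longleftrightarrow>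
     p \<noteq> [] \<and> hd p = u \<and> last p = v \<and> successively (\<lambda>x y. {x, y} \<in> E) p"

text \<open>The distance between vertices in different components is \<open>\<infinity>\<close>, the infimum of \<open>{}\<close>.\<close>

definition gdist :: "'a set set \<Rightarrow> 'a \<Rightarrow> 'a \<Rightarrow> enat" where
  "gdist E u v = (INF p \<in> {p. walk E u p v}. enat (length p - 1))"

text \<open>For finite nonempty \<open>T\<close> the supremum is the maximum; for \<open>T = {}\<close> it is \<open>0\<close>.\<close>

definition ecc :: "'a set set \<Rightarrow> 'a set \<Rightarrow> 'a \<Rightarrow> enat" where
  "ecc E T v = (SUP u\<in>T. gdist E v u)"


section \<open>A randomized word RAM\<close>

text \<open>
  Programs have finitely many scalar variables and arrays, named by numerals in the program text.
  Every result of arithmetic is truncated to \<open>w\<close> bits, so that the unit-cost measure below cannot be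
  abused by packing data into long numbers. Subtraction is the truncated one on \<^typ>\<open>nat\<close>.
\<close>

datatype binop = Plus | Minus | Times | Div | Mod | Less | Equal

datatype expr =
    Const nat
  | Var nat
  | Read nat expr
  | Op binop expr expr

datatype com =
    Skip
  | Assign nat expr
  | Write nat expr expr
  | Flip nat
  | Seq com com
  | If expr com com
  | While expr com

record state =
  vars :: "nat \<Rightarrow> nat"
  arrs :: "nat \<Rightarrow> nat \<Rightarrow> nat"

fun binop_fun :: "binop \<Rightarrow> nat \<Rightarrow> nat \<Rightarrow> nat" where
  "binop_fun Plus x y = x + y"
| "binop_fun Minus x y = x - y"
| "binop_fun Times x y = x * y"
| "binop_fun Div x y = x div y"
| "binop_fun Mod x y = x mod y"
| "binop_fun Less x y = of_bool (x < y)"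
| "binop_fun Equal x y = of_bool (x = y)"

primrec eval_expr :: "nat \<Rightarrow> expr \<Rightarrow> state \<Rightarrow> nat" where
  "eval_expr w (Const k) s = k mod 2 ^ w"
| "eval_expr w (Var x) s = vars s x"
| "eval_expr w (Read a e) s = arrs s a (eval_expr w e s)"
| "eval_expr w (Op f e1 e2) s = binop_fun f (eval_expr w e1 s) (eval_expr w e2 s) mod 2 ^ w"

definition set_var :: "nat \<Rightarrow> nat \<Rightarrow> state \<Rightarrow> state" where
  "set_var x k s = s\<lparr>vars := (vars s)(x := k)\<rparr>"

definition set_arr :: "nat \<Rightarrow> nat \<Rightarrow> nat \<Rightarrow> state \<Rightarrow> state" where
  "set_arr a i k s = s\<lparr>arrs := (arrs s)(a := (arrs s a)(i := k))\<rparr>"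

text \<open>
  One unit of time. The expressions occurring in a fixed program have bounded size, so a step
  performs a constant number of word operations. \<open>Skip\<close> is the halted program.
\<close>

primrec step :: "nat \<Rightarrow> com \<Rightarrow> state \<Rightarrow> (com \<times> state) pmf" where
  "step w Skip s = return_pmf (Skip, s)"
| "step w (Assign x e) s = return_pmf (Skip, set_var x (eval_expr w e s) s)"
| "step w (Write a i e) s =
     return_pmf (Skip, set_arr a (eval_expr w i s) (eval_expr w e s) s)"
| "step w (Flip x) s = map_pmf (\<lambda>b. (Skip, set_var x b s)) (pmf_of_set {0, 1})"
| "step w (Seq c1 c2) s =
     (if c1 = Skip then return_pmf (c2, s)
      else map_pmf (\<lambda>(c1', s'). (Seq c1' c2, s')) (step w c1 s))"
| "step w (If e c1 c2) s = return_pmf (if eval_expr w e s \<noteq> 0 then c1 else c2, s)"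
| "step w (While e c) s =
     return_pmf (if eval_expr w e s \<noteq> 0 then Seq c (While e c) else Skip, s)"

primrec run :: "nat \<Rightarrow> nat \<Rightarrow> com \<Rightarrow> state \<Rightarrow> (com \<times> state) pmf" where
  "run w 0 c s = return_pmf (c, s)"
| "run w (Suc t) c s = bind_pmf (step w c s) (\<lambda>(c', s'). run w t c' s')"

text \<open>Halting for every outcome of the coin flips, i.e. worst-case running time.\<close>

definition halts_within :: "nat \<Rightarrow> nat \<Rightarrow> com \<Rightarrow> state \<Rightarrow> bool" where
  "halts_within w t c s \<longleftrightarrow> (\<forall>(c', s') \<in> set_pmf (run w t c s). c' = Skip)"

text \<open>Words of \<open>\<Theta>(log n)\<close> bits; for \<open>K \<ge> 2\<close> every number in the input below fits into a word.\<close>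

definition word_len :: "nat \<Rightarrow> nat \<Rightarrow> nat" where
  "word_len K n = K * nat \<lceil>log 2 (real n + 2)\<rceil>"


section \<open>Input and output\<close>

text \<open>Each edge is listed exactly once, in arbitrary order and with arbitrary orientation.\<close>

definition edge_list :: "'a set set \<Rightarrow> ('a \<times> 'a) list \<Rightarrow> bool" where
  "edge_list E es \<longleftrightarrow>
     distinct (map (\<lambda>(u, v). {u, v}) es) \<and> set (map (\<lambda>(u, v). {u, v}) es) = E"

text \<open>
  Variables 0 and 1 hold the numbers of vertices and edges, arrays 0 and 1 the two endpoints of the
  edges, and arrays 2 and 3 the characteristic vectors of \<open>S\<close> and \<open>T\<close>. All other memory is \<open>0\<close>.
\<close>

definition input_state ::
    "nat \<Rightarrow> (nat \<times> nat) list \<Rightarrow> nat set \<Rightarrow> nat set \<Rightarrow> state" where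
  "input_state n es S T =
     \<lparr>vars = (\<lambda>x. if x = 0 then n else if x = 1 then length es else 0),
      arrs = (\<lambda>a i.
        if a = 0 \<and> i < length es then fst (es ! i)
        else if a = 1 \<and> i < length es then snd (es ! i)
        else if a = 2 then of_bool (i \<in> S)
        else if a = 3 then of_bool (i \<in> T)
        else 0)\<rparr>"

text \<open>
  The estimate for \<open>v\<close> is read from array 4. A finite distance is less than \<open>n\<close>, so the values
  \<open>\<ge> n\<close> are free to encode \<open>\<infinity>\<close>.
\<close>

definition estimate :: "nat \<Rightarrow> state \<Rightarrow> nat \<Rightarrow> enat" where
  "estimate n s v = (if arrs s 4 v < n then enat (arrs s 4 v) else \<infinity>)"

end

theory Submission
  imports Defs
begin

text \<open>
  The algorithm is deterministic. Let \<open>r\<close> be about \<open>sqrt n\<close> and pick centres \<open>w\<^sub>1, \<dots>, w\<^sub>r\<close> in \<open>T\<close> greedily,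
  each as far as possible from the previous ones. Among the sets of the \<open>r\<close> vertices closest to a
  centre choose the one reaching farthest, and call it \<open>N\<close>. A breadth-first search from every centre and
  every vertex of \<open>N\<close> yields the lower bounds \<open>d(w\<^sub>i, v)\<close> and \<open>\<epsilon>(y) - d(y, v)\<close> for \<open>y \<in> N\<close> on \<open>\<epsilon>(v)\<close>; the
  estimate \<open>k\<close> is the largest of them. Let \<open>t \<in> T\<close> be farthest from \<open>v\<close>. All centres are within
  distance \<open>k\<close> of \<open>v\<close>, so at distance at least \<open>\<epsilon>(v) - k\<close> from \<open>t\<close> and hence, by greediness, from each other.
  The balls of almost half that radius are disjoint, so one of them has at most \<open>r\<close> elements, and
  \<open>N\<close> contains a ball of this radius around its centre. The vertex \<open>y\<close> where the geodesic to \<open>v\<close> leaves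
  the ball gives \<open>\<epsilon>(v) \<le> k + 2 d(y, v)\<close>, which amounts to \<open>\<epsilon>(v) \<le> 2 k + 1\<close>.
\<close>

section \<open>Timed execution of deterministic programs\<close>

text \<open>The radius at which some ball is small depends on \<open>v\<close>, but the searches may
  not: taking the centre whose \<open>r\<close>-th nearest vertex is farthest yields one set that
  contains, for every such radius, a whole ball around this centre. Centres are taken from
  \<open>T\<close> so that their distances to \<open>v\<close> are themselves lower bounds on the
  eccentricity.

  All searches stay in the component of one vertex of \<open>T\<close>. This loses nothing, as for
  nonempty \<open>T\<close> an eccentricity is finite only if \<open>v\<close> and all of
  \<open>T\<close> lie in that component. It also saves time: a component has at most
  \<open>2 * m + 1\<close> vertices, so a search in fresh memory costs O(m + 1), and
  \<open>2 * r\<close> of them stay within O(m sqrt n + n) even on sparse graphs.\<close>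

inductive det_steps :: "nat \<Rightarrow> com \<Rightarrow> state \<Rightarrow> nat \<Rightarrow> com \<Rightarrow> state \<Rightarrow> bool" for w where
  halt: "det_steps w c s 0 c s"
| step: "c \<noteq> Skip \<Longrightarrow> step w c s = return_pmf (c1, s1) \<Longrightarrow> det_steps w c1 s1 t c' s'
    \<Longrightarrow> det_steps w c s (Suc t) c' s'"

lemma det_steps_run: "det_steps w c s t c' s' \<Longrightarrow> run w t c s = return_pmf (c', s')"
  by (induction rule: det_steps.induct) (simp_all add: bind_return_pmf)

lemma det_steps_trans:
  "det_steps w c s t c' s' \<Longrightarrow> det_steps w c' s' t' c'' s'' \<Longrightarrow> det_steps w c s (t + t') c'' s''"
  by (induction rule: det_steps.induct) (auto intro: det_steps.step)

lemma det_steps_one: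
  "c \<noteq> Skip \<Longrightarrow> step w c s = return_pmf (c1, s1) \<Longrightarrow> det_steps w c s 1 c1 s1"
  using det_steps.step[OF _ _ det_steps.halt] by simp

lemma det_steps_Seq: "det_steps w c s t c' s' \<Longrightarrow> det_steps w (Seq c d) s t (Seq c' d) s'"
proof (induction rule: det_steps.induct)
  case (step c s c1 s1 t c' s')
  then show ?case by (intro det_steps.step[of "Seq c d" w s "Seq c1 d" s1]) simp_all
qed (rule det_steps.halt)

section \<open>Frame conditions from the program text\<close>

primrec var_mods :: "com \<Rightarrow> nat set" where
  "var_mods Skip = {}"
| "var_mods (Assign x e) = {x}"
| "var_mods (Write a i e) = {}"
| "var_mods (Flip x) = {x}"
| "var_mods (Seq c d) = var_mods c \<union> var_mods d"
| "var_mods (If e c d) = var_mods c \<union> var_mods d"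
| "var_mods (While e c) = var_mods c"

primrec arr_mods :: "com \<Rightarrow> nat set" where
  "arr_mods Skip = {}"
| "arr_mods (Assign x e) = {}"
| "arr_mods (Write a i e) = {a}"
| "arr_mods (Flip x) = {}"
| "arr_mods (Seq c d) = arr_mods c \<union> arr_mods d"
| "arr_mods (If e c d) = arr_mods c \<union> arr_mods d"
| "arr_mods (While e c) = arr_mods c"

text \<open>The proof rules for consequence and loops supply this relation, so that an invariant has
  to mention only what the loop changes.\<close>

definition agree :: "com \<Rightarrow> state \<Rightarrow> state \<Rightarrow> bool" where
  "agree c s s' \<longleftrightarrow> (\<forall>x. x \<notin> var_mods c \<longrightarrow> vars s' x = vars s x) \<and>
     (\<forall>a. a \<notin> arr_mods c \<longrightarrow> arrs s' a = arrs s a)"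

lemma agree_refl: "agree c s s"
  by (simp add: agree_def)

lemma agree_trans: "agree c s s' \<Longrightarrow> agree c s' s'' \<Longrightarrow> agree c s s''"
  by (simp add: agree_def)

lemma agree_vars: "agree c s s' \<Longrightarrow> x \<notin> var_mods c \<Longrightarrow> vars s' x = vars s x"
  by (simp add: agree_def)

lemma agree_arrs: "agree c s s' \<Longrightarrow> a \<notin> arr_mods c \<Longrightarrow> arrs s' a = arrs s a"
  by (simp add: agree_def)

lemma vars_set_var [simp]: "vars (set_var x k s) = (vars s)(x := k)"
  and arrs_set_var [simp]: "arrs (set_var x k s) = arrs s"
  and vars_set_arr [simp]: "vars (set_arr a i k s) = vars s"
  and arrs_set_arr [simp]: "arrs (set_arr a i k s) = (arrs s)(a := (arrs s a)(i := k))"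
  by (simp_all add: set_var_def set_arr_def)

text \<open>The residual program modifies no more than the original one; this is what carries the
  frame from one step to a whole execution.\<close>

lemma step_agree:
  "(c', s') \<in> set_pmf (step w c s) \<Longrightarrow>
     agree c s s' \<and> var_mods c' \<subseteq> var_mods c \<and> arr_mods c' \<subseteq> arr_mods c"
proof (induction c arbitrary: c' s')
  case (Seq c d)
  show ?case
  proof (cases "c = Skip")
    case True
    with Seq.prems show ?thesis by (simp add: agree_def)
  next
    case False
    with Seq.prems have "(c', s') \<in> (\<lambda>(c1, s1). (Seq c1 d, s1)) ` set_pmf (step w c s)"
      by simp
    then obtain c1 where "(c1, s') \<in> set_pmf (step w c s)" "c' = Seq c1 d"
      by auto
    with Seq.IH(1) show ?thesis by (auto simp: agree_def)
  qed
next
  case (Flip x)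
  then show ?case by (auto simp: agree_def)
next
  case (If e c d)
  then show ?case by (simp add: agree_refl)
next
  case (While e c)
  then show ?case by (simp add: agree_refl)
qed (simp_all add: agree_def)

lemma det_steps_agree: "det_steps w c s t c' s' \<Longrightarrow> agree c s s'"
proof (induction rule: det_steps.induct)
  case (step c s c1 s1 t c' s')
  then have "agree c s s1 \<and> var_mods c1 \<subseteq> var_mods c \<and> arr_mods c1 \<subseteq> arr_mods c"
    by (intro step_agree[of _ _ w]) simp
  with step.IH show ?case by (auto simp: agree_def subset_iff)
qed (rule agree_refl)

text \<open>The postcondition also receives the elapsed time, counted from the value \<open>t\<close> at the start.\<close>

definition wp :: "nat \<Rightarrow> com \<Rightarrow> (state \<Rightarrow> nat \<Rightarrow> bool) \<Rightarrow> state \<Rightarrow> nat \<Rightarrow> bool" where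
  "wp w c Q s t \<longleftrightarrow> (\<exists>t' s'. det_steps w c s t' Skip s' \<and> Q s' (t + t'))"

lemma wp_conseq:
  "wp w c Q s t \<Longrightarrow> (\<And>s' t'. agree c s s' \<Longrightarrow> Q s' t' \<Longrightarrow> Q' s' t') \<Longrightarrow> wp w c Q' s t"
  unfolding wp_def using det_steps_agree by blast

primrec val :: "expr \<Rightarrow> state \<Rightarrow> nat" where
  "val (Const k) s = k"
| "val (Var x) s = vars s x"
| "val (Read a e) s = arrs s a (val e s)"
| "val (Op f e1 e2) s = binop_fun f (val e1 s) (val e2 s)"

text \<open>No intermediate result is affected by the truncation to words.\<close>

primrec fits :: "nat \<Rightarrow> expr \<Rightarrow> state \<Rightarrow> bool" where
  "fits w (Const k) s \<longleftrightarrow> k < 2 ^ w"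
| "fits w (Var x) s \<longleftrightarrow> True"
| "fits w (Read a e) s \<longleftrightarrow> fits w e s"
| "fits w (Op f e1 e2) s \<longleftrightarrow>
     fits w e1 s \<and> fits w e2 s \<and> binop_fun f (val e1 s) (val e2 s) < 2 ^ w"

lemma eval_expr_fits: "fits w e s \<Longrightarrow> eval_expr w e s = val e s"
  by (induction e) auto

lemma wp_Skip: "Q s t \<Longrightarrow> wp w Skip Q s t"
  unfolding wp_def using det_steps.halt by fastforce

lemma wp_Assign:
  assumes "fits w e s" and "Q (set_var x (val e s) s) (t + 1)"
  shows "wp w (Assign x e) Q s t"
  unfolding wp_def using assms det_steps_one[of "Assign x e" w s, OF _ step.simps(2)]
  by (fastforce simp: eval_expr_fits)

lemma wp_Write:
  assumes "fits w i s" and "fits w e s" and "Q (set_arr a (val i s) (val e s) s) (t + 1)"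
  shows "wp w (Write a i e) Q s t"
  unfolding wp_def using assms det_steps_one[of "Write a i e" w s, OF _ step.simps(3)]
  by (fastforce simp: eval_expr_fits)

lemma wp_Seq:
  assumes "wp w c (\<lambda>s' t'. wp w d Q s' (t' + 1)) s t"
  shows "wp w (Seq c d) Q s t"
proof -
  from assms obtain t1 s1 t2 s2 where *: "det_steps w c s t1 Skip s1" "det_steps w d s1 t2 Skip s2"
    "Q s2 (t + t1 + 1 + t2)" unfolding wp_def by blast
  have "det_steps w (Seq Skip d) s1 1 d s1" by (rule det_steps_one) simp_all
  with * have "det_steps w (Seq c d) s (t1 + (1 + t2)) Skip s2"
    by (blast intro: det_steps_trans det_steps_Seq)
  with * show ?thesis unfolding wp_def by (metis add.assoc)
qed

lemma wp_unfold:
  assumes "c \<noteq> Skip" and "step w c s = return_pmf (c', s)" and "wp w c' Q s (t + 1)"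
  shows "wp w c Q s t"
  using assms unfolding wp_def by (metis Suc_eq_plus1_left add.assoc det_steps.step)

lemma wp_If:
  assumes "fits w e s" and "val e s \<noteq> 0 \<Longrightarrow> wp w c Q s (t + 1)" and "val e s = 0 \<Longrightarrow> wp w d Q s (t + 1)"
  shows "wp w (If e c d) Q s t"
  by (rule wp_unfold[where c' = "if val e s \<noteq> 0 then c else d"])
     (use assms in \<open>auto simp: eval_expr_fits\<close>)

text \<open>The loop invariant may depend on a ghost value \<open>g\<close>, which carries the termination measure.\<close>

lemma wp_While:
  assumes init: "I g s t"
    and fits: "\<And>g s' t. I g s' t \<Longrightarrow> agree c s s' \<Longrightarrow> fits w e s'"
    and body: "\<And>g s' t. I g s' t \<Longrightarrow> agree c s s' \<Longrightarrow> val e s' \<noteq> 0 \<Longrightarrow>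
      wp w c (\<lambda>s'' t''. \<exists>g'. (f g' :: nat) < f g \<and> I g' s'' (t'' + 1)) s' (t + 1)"
    and exit: "\<And>g s' t. I g s' t \<Longrightarrow> agree c s s' \<Longrightarrow> val e s' = 0 \<Longrightarrow> Q s' (t + 1)"
  shows "wp w (While e c) Q s t"
proof -
  have "wp w (While e c) Q s' t" if "I g s' t" "agree c s s'" for g s' t
    using that
  proof (induction "f g" arbitrary: g s' t rule: less_induct)
    case less
    have ev: "eval_expr w e s' = val e s'"
      using fits less.prems eval_expr_fits by blast
    show ?case
    proof (cases "val e s' = 0")
      case True
      show ?thesis
        by (rule wp_unfold[where c' = Skip])
           (simp_all add: ev True wp_Skip exit[OF less.prems, simplified])
    next
      case False
      have "wp w (Seq c (While e c)) Q s' (t + 1)"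
      proof (rule wp_Seq, rule wp_conseq[OF body[OF less.prems False]])
        fix s'' t'' assume ag: "agree c s' s''" and "\<exists>g'. f g' < f g \<and> I g' s'' (t'' + 1)"
        then obtain g' where "f g' < f g" "I g' s'' (t'' + 1)" by blast
        then show "wp w (While e c) Q s'' (t'' + 1)"
          by (rule less.hyps) (rule agree_trans[OF less.prems(2) ag])
      qed
      then show ?thesis
        by (intro wp_unfold[of "While e c" w s' "Seq c (While e c)"]) (simp_all add: ev False)
    qed
  qed
  from this[OF init agree_refl] show ?thesis .
qed

text \<open>Straight-line code is executed symbolically by the simplifier, while a loop remains a
  \<open>wp\<close> goal for its invariant. \<open>Flip\<close> is refused because
  \<open>det_steps\<close> only follows steps with a single outcome.\<close>

primrec vc :: "nat \<Rightarrow> com \<Rightarrow> (state \<Rightarrow> nat \<Rightarrow> bool) \<Rightarrow> state \<Rightarrow> nat \<Rightarrow> bool" where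
  "vc w Skip Q s t \<longleftrightarrow> Q s t"
| "vc w (Assign x e) Q s t \<longleftrightarrow> fits w e s \<and> Q (set_var x (val e s) s) (t + 1)"
| "vc w (Write a i e) Q s t \<longleftrightarrow>
     fits w i s \<and> fits w e s \<and> Q (set_arr a (val i s) (val e s) s) (t + 1)"
| "vc w (Flip x) Q s t \<longleftrightarrow> False"
| "vc w (Seq c d) Q s t \<longleftrightarrow> vc w c (\<lambda>s' t'. vc w d Q s' (t' + 1)) s t"
| "vc w (If e c d) Q s t \<longleftrightarrow>
     fits w e s \<and> (if val e s \<noteq> 0 then vc w c Q s (t + 1) else vc w d Q s (t + 1))"
| "vc w (While e c) Q s t \<longleftrightarrow> wp w (While e c) Q s t"

lemma vc_wp: "vc w c Q s t \<Longrightarrow> wp w c Q s t"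
proof (induction c arbitrary: Q s t)
  case (Seq c d)
  then have "wp w c (\<lambda>s' t'. vc w d Q s' (t' + 1)) s t" by simp
  then show ?case by (rule wp_Seq[OF wp_conseq]) (rule Seq.IH(2))
next
  case (If e c d)
  then show ?case by (intro wp_If) simp_all
qed (simp_all add: wp_Skip wp_Assign wp_Write)

text \<open>Keeps the simplifier from executing the continuation before its initial state is known.\<close>

lemma vc_cong: "s = s' \<Longrightarrow> t = t' \<Longrightarrow> vc w c Q s t = vc w c Q s' t'"
  and wp_cong: "s = s' \<Longrightarrow> t = t' \<Longrightarrow> wp w c Q s t = wp w c Q s' t'"
  by simp_all

section \<open>Distances and breadth-first search\<close>

definition dst :: "('a \<Rightarrow> 'a \<Rightarrow> bool) \<Rightarrow> 'a \<Rightarrow> 'a \<Rightarrow> nat" where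
  "dst R u v = (LEAST k. (R ^^ k) u v)"

definition component :: "('a \<Rightarrow> 'a \<Rightarrow> bool) \<Rightarrow> 'a \<Rightarrow> 'a set" where
  "component R u = {v. R\<^sup>*\<^sup>* u v}"

lemma relpowp_dst: "v \<in> component R u \<Longrightarrow> (R ^^ dst R u v) u v"
  unfolding dst_def component_def by (auto simp: rtranclp_power intro: LeastI)

lemma dst_le: "(R ^^ k) u v \<Longrightarrow> dst R u v \<le> k"
  unfolding dst_def by (rule Least_le)

lemma relpowp_component: "(R ^^ k) u v \<Longrightarrow> v \<in> component R u"
  unfolding component_def by (auto simp: rtranclp_power)

lemma dst_self [simp]: "dst R u u = 0"
  using dst_le[of 0 R u u] by simp

lemma component_self [simp]: "u \<in> component R u"
  by (simp add: component_def)

lemma component_step: "z \<in> component R u \<Longrightarrow> R z v \<Longrightarrow> v \<in> component R u"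
  by (simp add: component_def)

lemma component_trans: "v \<in> component R u \<Longrightarrow> w \<in> component R v \<Longrightarrow> w \<in> component R u"
  by (simp add: component_def)

lemma component_sym: "symp R \<Longrightarrow> v \<in> component R u \<Longrightarrow> u \<in> component R v"
  by (simp add: component_def) (metis sympD symp_rtranclp)

lemma component_eq: "symp R \<Longrightarrow> v \<in> component R u \<Longrightarrow> component R v = component R u"
  using component_sym component_trans by (metis subsetI subset_antisym)

lemma dst_triangle:
  assumes "v \<in> component R u" and "w \<in> component R v"
  shows "dst R u w \<le> dst R u v + dst R v w"
proof (rule dst_le)
  show "(R ^^ (dst R u v + dst R v w)) u w"
    unfolding relpowp_add using assms by (intro relcomppI[of _ u v] relpowp_dst)
qed

lemma dst_zeroD: "v \<in> component R u \<Longrightarrow> dst R u v = 0 \<Longrightarrow> u = v"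
  using relpowp_dst[of v R u] by simp

lemma relpowp_sym: "symp R \<Longrightarrow> (R ^^ k) u v \<Longrightarrow> (R ^^ k) v u"
proof (induction k arbitrary: v)
  case (Suc k)
  then obtain z where "(R ^^ k) u z" "R z v" by (auto elim: relpowp_Suc_E)
  with Suc show ?case by (meson relpowp_Suc_I2 sympD)
qed simp

lemma dst_sym: "symp R \<Longrightarrow> dst R u v = dst R v u"
  unfolding dst_def by (metis relpowp_sym)

text \<open>The last vertex before \<open>v\<close> on a shortest path cannot be closer than
  \<open>k\<close>, since the final edge would otherwise give a shorter path to
  \<open>v\<close>.\<close>

lemma dst_Suc:
  assumes "v \<in> component R u" and "dst R u v = Suc k"
  obtains z where "z \<in> component R u" "dst R u z = k" "R z v"
proof -
  from relpowp_dst[OF assms(1)] assms(2) obtain z where z: "(R ^^ k) u z" "R z v"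
    by (auto elim: relpowp_Suc_E)
  moreover have "Suc k \<le> Suc (dst R u z)"
    using dst_le[of "Suc (dst R u z)" R u v] relpowp_Suc_I[of _ R u z v] relpowp_dst[of z R u]
      relpowp_component[OF z(1)] z(2) assms(2) by metis
  ultimately show thesis
    using that[of z] relpowp_component[OF z(1)] dst_le[OF z(1)] by simp
qed

lemma dst_step: "z \<in> component R u \<Longrightarrow> R z v \<Longrightarrow> dst R u v \<le> Suc (dst R u z)"
  by (rule dst_le) (auto intro: relpowp_Suc_I relpowp_dst)

text \<open>A shortest path is cut after \<open>a\<close> steps; by the triangle inequality neither
  piece can be shortened.\<close>

lemma dst_between:
  assumes "v \<in> component R u" and "a \<le> dst R u v"
  obtains y where "y \<in> component R u" "v \<in> component R y" "dst R u y = a" "dst R y v = dst R u v - a"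
proof -
  have "(R ^^ (a + (dst R u v - a))) u v"
    using assms relpowp_dst by simp
  then obtain y where y: "(R ^^ a) u y" "(R ^^ (dst R u v - a)) y v"
    unfolding relpowp_add by blast
  have c: "y \<in> component R u" "v \<in> component R y" using relpowp_component[OF y(1)] relpowp_component[OF y(2)] .
  show thesis
    using that[OF c] dst_le[OF y(1)] dst_le[OF y(2)] dst_triangle[OF c] assms(2) by linarith
qed

text \<open>A shortest path meets every distance from \<open>0\<close> to its length. The bound
  keeps finite distances below \<open>n\<close>, where the codes for infinity begin.\<close>

lemma dst_less_card:
  assumes "finite (component R u)" and "v \<in> component R u"
  shows "dst R u v < card (component R u)"
proof -
  have "{..dst R u v} \<subseteq> dst R u ` component R u"
    using dst_between[OF assms(2)] by (metis atMost_iff imageI subsetI)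
  then have "card {..dst R u v} \<le> card (component R u)"
    using assms(1) by (meson surj_card_le)
  then show ?thesis by simp
qed

section \<open>Walks and the extended distance\<close>

lemma walk_Cons:
  "p \<noteq> [] \<Longrightarrow> walk E u (x # p) v \<longleftrightarrow> x = u \<and> {u, hd p} \<in> E \<and> walk E (hd p) p v"
  by (cases p) (auto simp: walk_def)

lemma relpowp_walk:
  "((\<lambda>x y. {x, y} \<in> E) ^^ k) u v \<longleftrightarrow> (\<exists>p. walk E u p v \<and> length p = Suc k)"
proof (induction k arbitrary: u)
  case 0
  show ?case
    by (auto simp: walk_def length_Suc_conv intro: exI[of _ "[u]"])
next
  case (Suc k)
  show ?case
  proof
    assume "((\<lambda>x y. {x, y} \<in> E) ^^ Suc k) u v"
    then obtain z where "{u, z} \<in> E" "((\<lambda>x y. {x, y} \<in> E) ^^ k) z v"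
      by (blast dest: relpowp_Suc_D2)
    with Suc obtain p where p: "{u, z} \<in> E" "walk E z p v" "length p = Suc k"
      by blast
    moreover from p have "p \<noteq> []" "hd p = z"
      by (auto simp: walk_def)
    ultimately show "\<exists>p. walk E u p v \<and> length p = Suc (Suc k)"
      by (intro exI[of _ "u # p"]) (simp add: walk_Cons)
  next
    assume "\<exists>p. walk E u p v \<and> length p = Suc (Suc k)"
    then obtain x p where "walk E u (x # p) v" "length p = Suc k"
      by (metis length_Suc_conv)
    moreover then have "p \<noteq> []" by auto
    ultimately have "{u, hd p} \<in> E" "((\<lambda>x y. {x, y} \<in> E) ^^ k) (hd p) v"
      using Suc by (auto simp: walk_Cons)
    then show "((\<lambda>x y. {x, y} \<in> E) ^^ Suc k) u v"
      by (rule relpowp_Suc_I2)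
  qed
qed

lemma gdist_eq:
  fixes E :: "'a set set"
  defines "R \<equiv> \<lambda>x y. {x, y} \<in> E"
  shows "gdist E u v = (if v \<in> component R u then enat (dst R u v) else \<infinity>)"
proof (cases "v \<in> component R u")
  case True
  then obtain p where p: "walk E u p v" "length p = Suc (dst R u v)"
    using relpowp_dst[of v R u] relpowp_walk[where E = E] unfolding R_def by blast
  have "dst R u v \<le> length p - 1" if "walk E u p v" for p
  proof (rule dst_le)
    have "length p = Suc (length p - 1)" using that by (cases p) (auto simp: walk_def)
    with that show "(R ^^ (length p - 1)) u v"
      unfolding R_def relpowp_walk by blast
  qed
  with p have "gdist E u v = enat (dst R u v)"
    unfolding gdist_def
    by (intro antisym INF_greatest INF_lower2[of p]) auto
  with True show ?thesis by simp
next
  case False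
  have "\<not> walk E u p v" for p
  proof
    assume w: "walk E u p v"
    then have "length p = Suc (length p - 1)" by (cases p) (auto simp: walk_def)
    with w have "(R ^^ (length p - 1)) u v"
      unfolding R_def relpowp_walk by blast
    with False show False by (auto dest: relpowp_component)
  qed
  with False show ?thesis by (simp add: gdist_def top_enat_def)
qed

section \<open>The approximation bound by packing balls around the centres\<close>

text \<open>The balls are indexed by positions in \<open>ws\<close>, not by vertices. A small
  \<open>T\<close> forces repeated centres, but these contradict the separation \<open>sep\<close>,
  so such repetitions are compatible only with a bound that already holds.\<close>

lemma greedy_centres_estimate:
  assumes sym: "symp R" and fin: "finite A" and A: "A = component R x0"
    and ws: "set ws \<subseteq> A" and c: "c \<in> set ws" and v: "v \<in> A" and t: "t \<in> A"
    and card: "card A < length ws * (r + 1)"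
    and greedy: "\<And>i. i < length ws \<Longrightarrow> 0 < i \<Longrightarrow>
      \<exists>j<i. \<forall>l<i. dst R (ws ! j) t \<le> dst R (ws ! l) (ws ! i)"
    and N: "\<And>w a. w \<in> set ws \<Longrightarrow> card {y \<in> A. dst R w y \<le> a} \<le> r \<Longrightarrow>
      {y \<in> A. dst R c y \<le> a} \<subseteq> N"
    and near: "\<And>w. w \<in> set ws \<Longrightarrow> dst R w v \<le> k"
    and lower: "\<And>y. y \<in> N \<Longrightarrow> dst R y t \<le> k + dst R y v"
  shows "dst R v t \<le> 2 * k + 1"
proof (rule ccontr)
  define d where "d = dst R v t"
  assume "\<not> dst R v t \<le> 2 * k + 1"
  then have d: "d > 2 * k + 1" by (simp add: d_def)
  have conn: "y \<in> component R x" if "x \<in> A" "y \<in> A" for x y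
    using that component_eq[OF sym] unfolding A by blast
  have tri: "dst R x z \<le> dst R x y + dst R y z" if "x \<in> A" "y \<in> A" "z \<in> A" for x y z
    using that by (intro dst_triangle conn)
  have far: "d - k \<le> dst R w t" if "w \<in> set ws" for w
    using tri[of v w t] near[OF that] ws that v t dst_sym[OF sym, of v w] by (auto simp: d_def)
  have sep: "d - k \<le> dst R (ws ! l) (ws ! i)" if "l < i" "i < length ws" for l i
  proof -
    from greedy[of i] that obtain j where "j < i" "dst R (ws ! j) t \<le> dst R (ws ! l) (ws ! i)"
      by auto
    with far[of "ws ! j"] that show ?thesis by simp
  qed
  \<comment> \<open>The largest \<open>a\<close> with \<open>2 * a < d - k\<close>, which is what
    disjointness needs; the rounding loss \<open>d - k \<le> 2 * a + 2\<close> is the source of the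
    final \<open>+ 1\<close>.\<close>
  define a where "a = (d - k - 1) div 2"
  have a: "2 * a < d - k" "d - k \<le> 2 * a + 2" using d by (auto simp: a_def)
  define B where "B = (\<lambda>i. {y \<in> A. dst R (ws ! i) y \<le> a})"
  have disj: "B i \<inter> B j = {}" if "i < j" "j < length ws" for i j
  proof (rule ccontr)
    assume "B i \<inter> B j \<noteq> {}"
    then obtain y where y: "y \<in> A" "dst R (ws ! i) y \<le> a" "dst R (ws ! j) y \<le> a"
      by (auto simp: B_def)
    have "dst R (ws ! i) (ws ! j) \<le> 2 * a"
      using tri[of "ws ! i" y "ws ! j"] y that ws dst_sym[OF sym, of y "ws ! j"]
        nth_mem[of i ws] nth_mem[of j ws] by force
    with sep[OF that] a show False by simp
  qed
  have "\<exists>i<length ws. card (B i) \<le> r"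
  proof (rule ccontr)
    assume "\<not> ?thesis"
    then have *: "r + 1 \<le> card (B i)" if "i < length ws" for i using that by force
    have "length ws * (r + 1) = (\<Sum>i<length ws. r + 1)" by simp
    also have "\<dots> \<le> (\<Sum>i<length ws. card (B i))"
      by (rule sum_mono) (use * in auto)
    also have "\<dots> = card (\<Union>i<length ws. B i)"
    proof (rule card_UN_disjoint[symmetric])
      show "\<forall>i\<in>{..<length ws}. finite (B i)" using fin by (simp add: B_def)
      show "\<forall>i\<in>{..<length ws}. \<forall>j\<in>{..<length ws}. i \<noteq> j \<longrightarrow> B i \<inter> B j = {}"
        using disj by (metis Int_commute lessThan_iff linorder_neqE_nat)
    qed simp
    also have "\<dots> \<le> card A"
      by (rule card_mono[OF fin]) (auto simp: B_def)
    finally show False using card by simp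
  qed
  then have sub: "{y \<in> A. dst R c y \<le> a} \<subseteq> N"
    using N nth_mem unfolding B_def by blast
  have cA: "c \<in> A" using c ws by auto
  \<comment> \<open>The minimum covers the case of \<open>v\<close> inside the ball, where
    \<open>y\<close> is \<open>v\<close> itself.\<close>
  obtain y where y: "y \<in> component R c" "dst R c y = min a (dst R c v)"
    "dst R y v = dst R c v - min a (dst R c v)"
    using dst_between[OF conn[OF cA v], of "min a (dst R c v)"] by auto
  have yA: "y \<in> A" using y cA component_trans A by metis
  then have "y \<in> N" using sub y by auto
  then have "dst R y t \<le> k + dst R y v" by (rule lower)
  moreover have "d \<le> dst R y v + dst R y t"
    using tri[OF v yA t] dst_sym[OF sym, of v y] by (simp add: d_def)
  ultimately have "d \<le> k + 2 * dst R y v" by simp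
  moreover have "dst R y v \<le> k - a" using near[OF c] y(3) by (auto simp: min_def)
  \<comment> \<open>For \<open>a \<le> k\<close>, the bounds \<open>d \<le> 3 * k - 2 * a\<close>
    and \<open>d \<le> k + 2 * a + 2\<close> add up to \<open>2 * d \<le> 4 * k + 2\<close>. For
    larger \<open>a\<close> the distance from \<open>y\<close> to \<open>v\<close> vanishes and
    \<open>d \<le> k\<close>.\<close>
  ultimately show False using a d by (cases "a \<le> k") auto
qed

section \<open>Vertices in order of distance and the queue invariant\<close>

definition bfs_order :: "('a \<Rightarrow> 'a \<Rightarrow> bool) \<Rightarrow> 'a \<Rightarrow> 'a list \<Rightarrow> bool" where
  "bfs_order R x q \<longleftrightarrow> distinct q \<and> set q = component R x \<and> sorted (map (dst R x) q)"

lemma bfs_order_take: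
  assumes q: "bfs_order R x q" and r: "r < length q" and y: "y \<in> component R x"
    and less: "dst R x y < dst R x (q ! r)"
  shows "y \<in> set (take r q)"
proof -
  obtain i where i: "i < length q" "q ! i = y"
    using q y unfolding bfs_order_def by (metis in_set_conv_nth)
  have "i < r"
  proof (rule ccontr)
    assume "\<not> i < r"
    then have "dst R x (q ! r) \<le> dst R x (q ! i)"
      using q i unfolding bfs_order_def by (auto simp: sorted_iff_nth_mono)
    with less i show False by simp
  qed
  with i show ?thesis by (metis in_set_conv_nth length_take min_less_iff_conj nth_take)
qed

text \<open>Otherwise the first \<open>r + 1\<close> queue entries would be distinct elements of the
  ball. The size of a ball is thereby tested by looking at a single queue entry.\<close>

lemma bfs_order_ball:
  assumes q: "bfs_order R x q" and r: "r < length q"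
    and card: "card {y \<in> component R x. dst R x y \<le> a} \<le> r"
  shows "a < dst R x (q ! r)"
proof (rule ccontr)
  assume "\<not> a < dst R x (q ! r)"
  moreover have "dst R x (q ! i) \<le> dst R x (q ! r)" if "i \<le> r" for i
    using q r that unfolding bfs_order_def by (auto simp: sorted_iff_nth_mono)
  ultimately have "dst R x (q ! i) \<le> a" if "i \<le> r" for i
    using that by (meson le_trans not_less)
  then have "set (take (Suc r) q) \<subseteq> {y \<in> component R x. dst R x y \<le> a}"
    using q r unfolding bfs_order_def
    by (auto simp: in_set_conv_nth dest: in_set_takeD)
  then have "card (set (take (Suc r) q)) \<le> card {y \<in> component R x. dst R x y \<le> a}"
  proof (rule card_mono[rotated])
    show "finite {y \<in> component R x. dst R x y \<le> a}"
      using q finite_set[of q] by (simp add: bfs_order_def)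
  qed
  moreover have "card (set (take (Suc r) q)) = Suc r"
    using q r by (subst distinct_card) (auto simp: bfs_order_def)
  ultimately show False using card by simp
qed

text \<open>The vertices \<open>q ! i\<close> with \<open>i < h\<close> have been expanded completely.\<close>

definition bfs_inv :: "('a \<Rightarrow> 'a \<Rightarrow> bool) \<Rightarrow> 'a \<Rightarrow> 'a list \<Rightarrow> nat \<Rightarrow> bool" where
  "bfs_inv R x q h \<longleftrightarrow> distinct q \<and> h \<le> length q \<and> x \<in> set q \<and> set q \<subseteq> component R x \<and>
     sorted (map (dst R x) q) \<and> (\<forall>i<h. \<forall>y. R (q ! i) y \<longrightarrow> y \<in> set q) \<and>
     (h < length q \<longrightarrow> (\<forall>y\<in>set q. dst R x y \<le> Suc (dst R x (q ! h))))"

lemma bfs_inv_init: "bfs_inv R x [x] 0"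
  by (simp add: bfs_inv_def)

text \<open>The predecessor of \<open>y\<close> on a shortest path is strictly closer than the head,
  so sortedness places it before the head; it has been expanded, and \<open>y\<close> was found then
  at the latest.\<close>

lemma bfs_inv_complete:
  assumes "bfs_inv R x q h" and "h < length q"
  shows "y \<in> component R x \<Longrightarrow> dst R x y \<le> dst R x (q ! h) \<Longrightarrow> y \<in> set q"
proof (induction "dst R x y" arbitrary: y)
  case 0
  then have "x = y" using dst_zeroD by metis
  with assms show ?case by (simp add: bfs_inv_def)
next
  case (Suc k)
  obtain z where z: "z \<in> component R x" "dst R x z = k" "R z y"
    using dst_Suc[OF Suc.prems(1) Suc.hyps(2)[symmetric]] .
  with Suc have "z \<in> set q" by simp
  then obtain i where i: "i < length q" "q ! i = z" by (metis in_set_conv_nth)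
  have "i < h"
  proof (rule ccontr)
    assume "\<not> i < h"
    then have "dst R x (q ! h) \<le> dst R x (q ! i)"
      using assms i unfolding bfs_inv_def by (auto simp: sorted_iff_nth_mono)
    with i z Suc show False by simp
  qed
  with i z assms show ?case unfolding bfs_inv_def by blast
qed

text \<open>The edge bounds the distance of \<open>y\<close> from above. It is bounded from below
  because every vertex no farther than the head is already in the queue.\<close>

lemma bfs_inv_discover:
  assumes inv: "bfs_inv R x q h" and h: "h < length q" and y: "y \<notin> set q" and edge: "R (q ! h) y"
  shows "dst R x y = Suc (dst R x (q ! h))" and "bfs_inv R x (q @ [y]) h"
proof -
  have hx: "q ! h \<in> component R x" using inv h unfolding bfs_inv_def by (meson nth_mem subsetD)
  then have yc: "y \<in> component R x" using edge by (rule component_step)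
  show d: "dst R x y = Suc (dst R x (q ! h))"
    using dst_step[OF hx edge] bfs_inv_complete[OF inv h yc] y by linarith
  show "bfs_inv R x (q @ [y]) h"
    using inv h y yc d by (auto simp: bfs_inv_def sorted_append nth_append)
qed

lemma bfs_inv_next:
  assumes inv: "bfs_inv R x q h" and h: "h < length q" and "\<And>y. R (q ! h) y \<Longrightarrow> y \<in> set q"
  shows "bfs_inv R x q (Suc h)"
proof -
  have "dst R x (q ! h) \<le> dst R x (q ! Suc h)" if "Suc h < length q"
    using inv that unfolding bfs_inv_def by (auto simp: sorted_iff_nth_mono)
  with assms show ?thesis
    unfolding bfs_inv_def by (auto simp: less_Suc_eq intro: order_trans)
qed

lemma bfs_inv_finish:
  assumes inv: "bfs_inv R x q (length q)"
  shows "bfs_order R x q"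
proof -
  have "y \<in> set q" if "R\<^sup>*\<^sup>* x y" for y
    using that
  proof (induction rule: rtranclp_induct)
    case (step y z)
    with inv show ?case unfolding bfs_inv_def by (metis in_set_conv_nth)
  qed (use inv in \<open>simp add: bfs_inv_def\<close>)
  with inv show ?thesis by (auto simp: bfs_inv_def bfs_order_def component_def)
qed

section \<open>The program\<close>

abbreviation (input) seq_com (infixr \<open>;;\<close> 60) where "c ;; d \<equiv> Seq c d"

text \<open>
  Array 4 holds the estimates; arrays 5, 6 and 7 the adjacency lists (head of the list of a vertex,
  successor and target of an arc, arcs being numbered from 1); array 10 the value \<open>n - d\<close> for the
  distance \<open>d\<close> to the nearest source processed so far. Every search uses \<open>n\<close> fresh cells of arrays 8
  and 9, starting at variable 5, for the distances plus one (\<open>0\<close> meaning undiscovered) and for the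
  queue, so that nothing has to be cleared.

  Variables: 2 source, 3 whether \<open>T \<noteq> {}\<close>, 4 loop counter, 6 and 7 head and tail of the queue, 8 current
  vertex, 9 current arc, 10 its target, 11 eccentricity of the source, 12 temporary, 13 number of
  centres, 15 position of the queue of the best centre and 14 the distance, plus one, of its \<open>r\<close>-th entry, 16 next centre, 17 its value in
  array 10, 18 whether \<open>T\<close> meets several components.
\<close>

definition link_edge :: com where
  "link_edge =
     Assign 8 (Read 0 (Var 4)) ;;
     Assign 10 (Read 1 (Var 4)) ;;
     Assign 9 (Op Plus (Op Times (Const 2) (Var 4)) (Const 1)) ;;
     Write 7 (Var 9) (Var 10) ;;
     Write 6 (Var 9) (Read 5 (Var 8)) ;;
     Write 5 (Var 8) (Var 9) ;;
     Assign 9 (Op Plus (Var 9) (Const 1)) ;;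
     Write 7 (Var 9) (Var 8) ;;
     Write 6 (Var 9) (Read 5 (Var 10)) ;;
     Write 5 (Var 10) (Var 9) ;;
     Assign 4 (Op Plus (Var 4) (Const 1))"

definition build :: com where
  "build = While (Op Less (Var 4) (Var 1)) link_edge"

definition scan_arc :: com where
  "scan_arc =
     Assign 10 (Read 7 (Var 9)) ;;
     If (Read 8 (Op Plus (Var 5) (Var 10))) Skip
       (Write 8 (Op Plus (Var 5) (Var 10))
          (Op Plus (Read 8 (Op Plus (Var 5) (Var 8))) (Const 1)) ;;
        Write 9 (Op Plus (Var 5) (Var 7)) (Var 10) ;;
        Assign 7 (Op Plus (Var 7) (Const 1))) ;;
     Assign 9 (Read 6 (Var 9))"

definition scan :: com where
  "scan = While (Var 9) scan_arc"

definition expand :: com where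
  "expand =
     Assign 8 (Read 9 (Op Plus (Var 5) (Var 6))) ;;
     If (Read 3 (Var 8))
       (Assign 11 (Op Minus (Read 8 (Op Plus (Var 5) (Var 8))) (Const 1))) Skip ;;
     Assign 9 (Read 5 (Var 8)) ;;
     scan ;;
     Assign 6 (Op Plus (Var 6) (Const 1))"

definition bfs :: com where
  "bfs =
     Write 8 (Op Plus (Var 5) (Var 2)) (Const 1) ;;
     Write 9 (Var 5) (Var 2) ;;
     Assign 6 (Const 0) ;;
     Assign 7 (Const 1) ;;
     Assign 11 (Const 0) ;;
     While (Op Less (Var 6) (Var 7)) expand"

text \<open>The second branch rewrites the old value so that both branches take equally long; the
  command then acts as a maximum with a fixed cost.\<close>

definition raise :: "nat \<Rightarrow> expr \<Rightarrow> com" where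
  "raise a e = If (Op Less (Read a (Var 8)) e) (Write a (Var 8) e)
     (Write a (Var 8) (Read a (Var 8)))"

definition update_vertex :: com where
  "update_vertex =
     Assign 8 (Read 9 (Op Plus (Var 5) (Var 6))) ;;
     Assign 12 (Op Minus (Read 8 (Op Plus (Var 5) (Var 8))) (Const 1)) ;;
     raise 4 (Op Minus (Var 11) (Var 12)) ;;
     If (Read 3 (Var 2)) (raise 4 (Var 12)) Skip ;;
     raise 10 (Op Minus (Var 0) (Var 12)) ;;
     If (Read 3 (Var 8))
       (If (Op Less (Read 10 (Var 8)) (Var 17))
          (Assign 17 (Read 10 (Var 8)) ;; Assign 16 (Var 8)) Skip) Skip ;;
     Assign 6 (Op Plus (Var 6) (Const 1))"

text \<open>A second pass over the queue is needed because the eccentricity of the source is known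
  only when the search ends. The initial \<open>n + 1\<close> exceeds every entry of array 10, so
  the first vertex of \<open>T\<close> is always accepted.\<close>

definition update :: com where
  "update =
     Assign 6 (Const 0) ;;
     Assign 17 (Op Plus (Var 0) (Const 1)) ;;
     While (Op Less (Var 6) (Var 7)) update_vertex"

section \<open>Adjacency lists as linked lists\<close>

text \<open>Here \<open>0\<close> is the null pointer, so zeroed memory represents empty lists and
  arc numbers have to be positive.\<close>

primrec chain :: "(nat \<Rightarrow> nat) \<Rightarrow> nat \<Rightarrow> nat list \<Rightarrow> bool" where
  "chain f a [] \<longleftrightarrow> a = 0"
| "chain f a (x # xs) \<longleftrightarrow> a = x \<and> x \<noteq> 0 \<and> chain f (f x) xs"

lemma chain_cong: "(\<And>x. x \<in> set xs \<Longrightarrow> f x = g x) \<Longrightarrow> chain f a xs = chain g a xs"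
  by (induction xs arbitrary: a) auto

primrec nbrs :: "('a \<times> 'a) list \<Rightarrow> 'a \<Rightarrow> 'a list" where
  "nbrs [] u = []"
| "nbrs (e # es) u =
     (if u = fst e then [snd e] else if u = snd e then [fst e] else []) @ nbrs es u"

lemma nbrs_append: "nbrs (es @ fs) u = nbrs es u @ nbrs fs u"
  by (induction es) auto

lemma set_nbrs:
  assumes "set (map (\<lambda>(u, v). {u, v}) es) = E"
  shows "set (nbrs es u) = {y. {u, y} \<in> E}"
proof -
  have "set (nbrs es u) = {y. {u, y} \<in> set (map (\<lambda>(u, v). {u, v}) es)}"
  proof (induction es)
    case (Cons e es)
    then show ?case by (cases e) (auto simp: doubleton_eq_iff)
  qed simp
  with assms show ?thesis by simp
qed

text \<open>The handshake count: an edge contributes at most once at each of its two ends.\<close>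

lemma sum_length_nbrs: "finite A \<Longrightarrow> (\<Sum>u\<in>A. length (nbrs es u)) \<le> 2 * length es"
proof (induction es)
  case (Cons e es)
  have "(\<Sum>u\<in>A. length (nbrs (e # es) u))
      \<le> (\<Sum>u\<in>A. (if u = fst e then 1 else 0) + (if u = snd e then 1 else 0) + length (nbrs es u))"
    by (rule sum_mono) auto
  also have "\<dots> \<le> 2 + (\<Sum>u\<in>A. length (nbrs es u))"
    using Cons.prems by (simp add: sum.distrib)
  finally show ?case using Cons by simp
qed simp

text \<open>Arcs are pushed at the front of a list, hence the reversal. The bound on arc numbers
  ensures that the two arcs of the next edge are fresh.\<close>

definition adj_upto ::
    "(nat \<times> nat) list \<Rightarrow> (nat \<Rightarrow> nat) \<Rightarrow> (nat \<Rightarrow> nat) \<Rightarrow> (nat \<Rightarrow> nat) \<Rightarrow> bool" where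
  "adj_upto es h nx tg \<longleftrightarrow>
     (\<forall>u. \<exists>as. chain nx (h u) as \<and> map tg as = rev (nbrs es u) \<and> set as \<subseteq> {..2 * length es})"

lemma adj_upto_snoc:
  assumes adj: "adj_upto es h nx tg" and ne: "u \<noteq> v"
  defines "a \<equiv> Suc (2 * length es)"
  shows "adj_upto (es @ [(u, v)]) (h(u := a, v := Suc a)) (nx(a := h u, Suc a := h v))
    (tg(a := v, Suc a := u))"
  unfolding adj_upto_def
proof (intro allI)
  fix x
  obtain as where as: "chain nx (h x) as" "map tg as = rev (nbrs es x)" "set as \<subseteq> {..2 * length es}"
    using adj unfolding adj_upto_def by blast
  define as' where "as' = (if x = u then [a] else if x = v then [Suc a] else []) @ as"
  \<comment> \<open>The updated positions exceed \<open>2 * length es\<close>, so no old list passes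
    through them.\<close>
  have "chain (nx(a := h u, Suc a := h v)) c as = chain nx c as" for c
    by (rule chain_cong) (use as(3) in \<open>auto simp: a_def\<close>)
  moreover have "map (tg(a := v, Suc a := u)) as = map tg as"
    using as(3) by (auto simp: a_def)
  ultimately show "\<exists>as. chain (nx(a := h u, Suc a := h v)) ((h(u := a, v := Suc a)) x) as \<and>
      map (tg(a := v, Suc a := u)) as = rev (nbrs (es @ [(u, v)]) x) \<and>
      set as \<subseteq> {..2 * length (es @ [(u, v)])}"
    using as ne by (intro exI[of _ as']) (auto simp: as'_def nbrs_append a_def)
qed

section \<open>A fixed input: components, degrees and word size\<close>

locale st_instance =
  fixes n :: nat and E :: "nat set set" and es :: "(nat \<times> nat) list" and T :: "nat set" and w :: nat
  assumes n: "1 \<le> n" and graph: "simple_graph n E" and edges: "edge_list E es"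
    and T: "T \<subseteq> {..<n}" and word: "8 * (n + 2) ^ 2 < 2 ^ w"
begin

definition R :: "nat \<Rightarrow> nat \<Rightarrow> bool" where
  "R u v \<longleftrightarrow> {u, v} \<in> E"

abbreviation m :: nat where
  "m \<equiv> length es"

abbreviation d :: "nat \<Rightarrow> nat \<Rightarrow> nat" where
  "d \<equiv> dst R"

lemma sym: "symp R"
  by (auto simp: symp_def R_def insert_commute)

lemma R_less: "R u v \<Longrightarrow> u < n \<and> v < n"
  using graph unfolding R_def simple_graph_def by (force simp: doubleton_eq_iff)

lemma set_es: "set (map (\<lambda>(u, v). {u, v}) es) = E"
  using edges by (simp add: edge_list_def)

lemma es_nth:
  assumes "j < m"
  shows "fst (es ! j) < n" "snd (es ! j) < n" "fst (es ! j) \<noteq> snd (es ! j)"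
proof -
  have "{fst (es ! j), snd (es ! j)} \<in> E"
    using assms set_es by (force simp: split_beta)
  then show "fst (es ! j) < n" "snd (es ! j) < n" "fst (es ! j) \<noteq> snd (es ! j)"
    using graph unfolding simple_graph_def by (force simp: doubleton_eq_iff)+
qed

lemma m_eq: "m = card E"
proof -
  have "card (set (map (\<lambda>(u, v). {u, v}) es)) = length (map (\<lambda>(u, v). {u, v}) es)"
    using edges unfolding edge_list_def by (intro distinct_card) blast
  then show ?thesis by (simp only: set_es length_map)
qed

lemma m_le: "m \<le> n * n"
proof -
  have "E \<subseteq> (\<lambda>(u, v). {u, v}) ` ({..<n} \<times> {..<n})"
    using graph unfolding simple_graph_def by force
  then have "card E \<le> card ({..<n} \<times> {..<n})"
    by (meson finite_SigmaI finite_lessThan surj_card_le)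
  then show ?thesis by (simp add: m_eq)
qed

text \<open>Quadratic room is needed for arc numbers up to \<open>2 * m\<close>, for the addresses
  of \<open>2 * r\<close> blocks of \<open>n\<close> cells, and for the squares compared in
  \<open>root\<close>.\<close>

lemma word_bounds: "8 * (n * n) + 32 * n + 32 < 2 ^ w"
  using word by (simp add: power2_eq_square algebra_simps)

lemma component_less: "x < n \<Longrightarrow> y \<in> component R x \<Longrightarrow> y < n"
  unfolding component_def mem_Collect_eq by (erule rtranclp.cases) (auto dest: R_less)

lemma finite_component: "x < n \<Longrightarrow> finite (component R x)"
  by (rule finite_subset[of _ "{..<n}"]) (auto dest: component_less)

lemma card_component: "x < n \<Longrightarrow> card (component R x) \<le> n"
  using card_mono[of "{..<n}" "component R x"] component_less by auto

lemma d_less: "x < n \<Longrightarrow> y \<in> component R x \<Longrightarrow> d x y < n"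
  using dst_less_card[OF finite_component] card_component by (meson order_less_le_trans)

lemma set_nbrs_R: "set (nbrs es u) = {y. R u y}"
  using set_nbrs[OF set_es] by (simp add: R_def)

definition work :: "nat list \<Rightarrow> nat" where
  "work q = (\<Sum>u\<leftarrow>q. 1 + length (nbrs es u))"

text \<open>Every vertex of the component except \<open>x\<close> has a neighbour.\<close>

lemma work_le:
  assumes "x < n" and "distinct q" and "set q \<subseteq> component R x"
  shows "work q \<le> 4 * m + 1" and "length q \<le> 2 * m + 1"
proof -
  have fin: "finite (set q)" by simp
  have sum: "(\<Sum>u\<in>set q. length (nbrs es u)) \<le> 2 * m"
    by (rule sum_length_nbrs) simp
  have "1 \<le> length (nbrs es u)" if u: "u \<in> set q - {x}" for u
  proof -
    have "R\<^sup>*\<^sup>* x u" "x \<noteq> u" using u assms by (auto simp: component_def)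
    then obtain z where "R z u" by (metis rtranclp.cases)
    then have "R u z" using sym by (simp add: sympD)
    then have "nbrs es u \<noteq> []" using set_nbrs_R[of u] by force
    then show ?thesis by (cases "nbrs es u") auto
  qed
  then have "(\<Sum>u\<in>set q - {x}. 1) \<le> (\<Sum>u\<in>set q - {x}. length (nbrs es u))"
    by (rule sum_mono)
  also have "\<dots> \<le> (\<Sum>u\<in>set q. length (nbrs es u))"
    by (rule sum_mono2) auto
  finally have "card (set q - {x}) \<le> 2 * m" using sum by simp
  moreover have "card (set q) \<le> Suc (card (set q - {x}))"
    by (metis card_Suc_Diff1 diff_le_self Suc_n_not_le_n card_Diff_singleton_if fin le_SucI nat_le_linear)
  ultimately show len: "length q \<le> 2 * m + 1"
    using distinct_card[OF assms(2)] by simp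
  have "work q = (\<Sum>u\<in>set q. 1 + length (nbrs es u))"
    unfolding work_def using assms(2) by (rule sum_list_distinct_conv_sum_set)
  also have "\<dots> = length q + (\<Sum>u\<in>set q. length (nbrs es u))"
    using distinct_card[OF assms(2)] by (simp only: sum.distrib) simp
  finally show "work q \<le> 4 * m + 1" using sum len by simp
qed

definition input :: "state \<Rightarrow> bool" where
  "input s \<longleftrightarrow> vars s 0 = n \<and> vars s 1 = m \<and>
     (\<forall>i<m. arrs s 0 i = fst (es ! i) \<and> arrs s 1 i = snd (es ! i)) \<and>
     (\<forall>i. arrs s 3 i = of_bool (i \<in> T))"

lemma input_agree:
  "agree c s s' \<Longrightarrow> input s \<Longrightarrow> {0, 1} \<inter> var_mods c = {} \<Longrightarrow> {0, 1, 3} \<inter> arr_mods c = {} \<Longrightarrow>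
     input s'"
  unfolding agree_def input_def by auto

definition adj :: "state \<Rightarrow> bool" where
  "adj s \<longleftrightarrow> adj_upto es (arrs s 5) (arrs s 6) (arrs s 7)"

lemma adj_agree: "agree c s s' \<Longrightarrow> adj s \<Longrightarrow> {5, 6, 7} \<inter> arr_mods c = {} \<Longrightarrow> adj s'"
  unfolding agree_def adj_def by auto

lemma wp_build:
  assumes inp: "input s" and i: "vars s 4 = 0" and hd: "arrs s 5 = (\<lambda>_. 0)"
  shows "wp w build (\<lambda>s' t'. adj s' \<and> t' \<le> t + 25 * m + 1) s t"
  unfolding build_def
proof (rule wp_While[where f = "\<lambda>j. m - j" and g = 0 and I = "\<lambda>j s' t'. vars s' 4 = j \<and> j \<le> m \<and>
    t' \<le> t + 25 * j \<and> adj_upto (take j es) (arrs s' 5) (arrs s' 6) (arrs s' 7)"], goal_cases)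
  case 1
  show ?case using i hd by (simp add: adj_upto_def)
next
  case (2 j s' t')
  show ?case using word_bounds by simp
next
  case (3 j s' t')
  have inp': "input s'"
    by (rule input_agree[OF 3(2) inp]) (simp_all add: link_edge_def)
  then have j: "j < m" using 3 by (simp add: input_def split: if_splits)
  define a where "a = Suc (2 * j)"
  define u where "u = fst (es ! j)"
  define v where "v = snd (es ! j)"
  have uv: "arrs s' 0 j = u" "arrs s' 1 j = v" "u \<noteq> v"
    using inp' j es_nth[OF j] by (simp_all add: input_def u_def v_def)
  have fit: "Suc (Suc (2 * j)) < 2 ^ w" "2 * j < 2 ^ w" "2 < (2 :: nat) ^ w" "1 < (2 :: nat) ^ w"
    using word_bounds m_le j by linarith+
  have "adj_upto (take j es @ [(u, v)]) ((arrs s' 5)(u := a, v := Suc a))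
      ((arrs s' 6)(a := arrs s' 5 u, Suc a := arrs s' 5 v)) ((arrs s' 7)(a := v, Suc a := u))"
    using adj_upto_snoc[of "take j es" "arrs s' 5" "arrs s' 6" "arrs s' 7" u v] 3(1) uv(3) j
    by (simp add: a_def min_def)
  moreover have "take j es @ [(u, v)] = take (Suc j) es"
    using j by (simp add: take_Suc_conv_app_nth u_def v_def)
  ultimately have adj: "adj_upto (take (Suc j) es) ((arrs s' 5)(u := a, v := Suc a))
      ((arrs s' 6)(a := arrs s' 5 u, Suc a := arrs s' 5 v)) ((arrs s' 7)(a := v, Suc a := u))"
    by simp
  show ?case
    unfolding link_edge_def
    by (rule vc_wp)
       (use 3(1) j fit adj uv in \<open>simp add: a_def exI[of _ "Suc j"] cong: vc_cong\<close>)
next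
  case (4 j s' t')
  have "input s'"
    by (rule input_agree[OF 4(2) inp]) (simp_all add: link_edge_def)
  with 4 have "j = m" by (simp add: input_def split: if_splits)
  with 4 show ?case by (simp add: adj_def)
qed

section \<open>One search and the updates derived from it\<close>

definition bfs_state :: "nat \<Rightarrow> nat \<Rightarrow> nat list \<Rightarrow> state \<Rightarrow> bool" where
  "bfs_state x b q s \<longleftrightarrow> vars s 7 = length q \<and> (\<forall>j<length q. arrs s 9 (b + j) = q ! j) \<and>
     (\<forall>y<n. arrs s 8 (b + y) = (if y \<in> set q then Suc (d x y) else 0))"

text \<open>Blocks of earlier searches survive, notably the queue that supplies the sources of the
  second phase, and cells beyond the current block stay zero for later searches.\<close>

definition same_outside :: "nat \<Rightarrow> state \<Rightarrow> state \<Rightarrow> bool" where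
  "same_outside b s s' \<longleftrightarrow> (\<forall>z. z < b \<or> b + n \<le> z \<longrightarrow>
     arrs s' 8 z = arrs s 8 z \<and> arrs s' 9 z = arrs s 9 z)"

lemma bfs_state_snoc:
  assumes "bfs_state x b q s" and "y \<notin> set q"
    and "vars s' 7 = Suc (length q)" and "arrs s' 8 = (arrs s 8)(b + y := Suc (d x y))"
    and "arrs s' 9 = (arrs s 9)(b + length q := y)"
  shows "bfs_state x b (q @ [y]) s'"
  using assms by (auto simp: bfs_state_def nth_append)

lemma bfs_inv_length:
  assumes "x < n" and "bfs_inv R x q h"
  shows "length q \<le> n"
proof -
  have "set q \<subseteq> {..<n}"
    using assms component_less[of x] unfolding bfs_inv_def by blast
  then have "card (set q) \<le> n" by (metis card_lessThan card_mono finite_lessThan)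
  with assms show ?thesis by (simp add: bfs_inv_def distinct_card)
qed

lemma wp_scan:
  assumes x: "x < n" and b: "vars s 5 = b" and bw: "b + 2 * n + 4 < 2 ^ w"
    and u: "vars s 8 = q ! h" and h: "h < length q" and inv: "bfs_inv R x q h"
    and st: "bfs_state x b q s" and chain: "chain (arrs s 6) (vars s 9) as"
    and tgt: "arrs s 7 ` set as = {y. R (q ! h) y}"
  shows "wp w scan (\<lambda>s' t'. (\<exists>p. bfs_inv R x (q @ p) h \<and> bfs_state x b (q @ p) s' \<and>
    (\<forall>y. R (q ! h) y \<longrightarrow> y \<in> set (q @ p))) \<and> same_outside b s s' \<and> t' \<le> t + 15 * length as + 1) s t"
  unfolding scan_def
\<comment> \<open>The ghost pair holds the vertices discovered by this scan and the arcs still to be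
  followed. The latter serve as a potential paying for the remaining time.\<close>
proof (rule wp_While[where g = "([], as)" and f = "\<lambda>(p, as'). length as'" and
    I = "\<lambda>(p, as') s' t'. bfs_inv R x (q @ p) h \<and> bfs_state x b (q @ p) s' \<and>
      chain (arrs s 6) (vars s' 9) as' \<and> arrs s 7 ` set as' \<subseteq> {y. R (q ! h) y} \<and>
      {y. R (q ! h) y} \<subseteq> set (q @ p) \<union> arrs s 7 ` set as' \<and> same_outside b s s' \<and>
      t' + 15 * length as' \<le> t + 15 * length as"], goal_cases)
  case 1
  show ?case using inv st chain tgt by (simp add: same_outside_def)
next
  case (2 g s' t')
  show ?case by simp
next
  case (3 g s' t')
  obtain p as' where g: "g = (p, as')" by fastforce
  define q' where "q' = q @ p"
  note I = 3(1)[unfolded g prod.case, folded q'_def]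
  obtain a as'' where as': "as' = a # as''" "vars s' 9 = a"
    using I 3(3) by (cases as') auto
  define y where "y = arrs s 7 a"
  have y: "R (q ! h) y" "y < n" using I as' R_less by (auto simp: y_def)
  have same: "vars s' 5 = b" "vars s' 8 = q ! h" "arrs s' 6 = arrs s 6" "arrs s' 7 = arrs s 7"
    using b u agree_vars[OF 3(2), of 5] agree_vars[OF 3(2), of 8] agree_arrs[OF 3(2), of 6]
      agree_arrs[OF 3(2), of 7] by (simp_all add: scan_arc_def)
  have h': "h < length q'" "q' ! h = q ! h" using h by (auto simp: q'_def nth_append)
  then have uq: "q ! h \<in> set q'" by (metis nth_mem)
  have ux: "q ! h \<in> component R x" using uq I unfolding bfs_inv_def by blast
  have un: "q ! h < n" "d x (q ! h) < n" using component_less[OF x ux] d_less[OF x ux] .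
  have Du: "arrs s' 8 (b + q ! h) = Suc (d x (q ! h))"
    using I uq un by (simp add: bfs_state_def)
  have Dy: "arrs s' 8 (b + y) = (if y \<in> set q' then Suc (d x y) else 0)"
    using I y by (simp add: bfs_state_def)
  have rest: "{y. R (q ! h) y} \<subseteq> insert y (set q') \<union> arrs s 7 ` set as''"
    "arrs s 7 ` set as'' \<subseteq> {y. R (q ! h) y}" "chain (arrs s 6) (arrs s 6 a) as''"
    using I as' by (auto simp: y_def)
  have word: "Suc 0 < 2 ^ w" "b + y < 2 ^ w" "b + q ! h < 2 ^ w" "Suc (Suc (d x (q ! h))) < 2 ^ w"
    "b + length q' < 2 ^ w" "Suc (length q') < 2 ^ w"
    using bw y(2) un bfs_inv_length[OF x, of q' h] I by linarith+
  have qt: "vars s' 7 = length q'" using I by (simp add: bfs_state_def)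
  show ?case
  proof (cases "y \<in> set q'")
    case True
    have "wp w scan_arc (\<lambda>s'' t''. vars s'' 7 = vars s' 7 \<and> arrs s'' 8 = arrs s' 8 \<and>
        arrs s'' 9 = arrs s' 9 \<and> vars s'' 9 = arrs s 6 a \<and> t'' \<le> t' + 12) s' (t' + 1)"
      unfolding scan_arc_def
      by (rule vc_wp) (simp add: same as' Dy True word flip: y_def cong: vc_cong)
    then show ?thesis
    proof (rule wp_conseq, goal_cases)
      case (1 s'' t'')
      then have "bfs_state x b q' s''" "same_outside b s s''"
        using I by (simp_all add: bfs_state_def same_outside_def)
      moreover have sub: "{y. R (q ! h) y} \<subseteq> set q' \<union> arrs s 7 ` set as''"
        using rest(1) True by blast
      ultimately show ?case
        using 1 I rest as'(1)
        by (intro exI[of _ "(p, as'')"]) (simp add: g q'_def)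
    qed
  next
    case False
    note disc = bfs_inv_discover[of R x q' h y, OF _ h'(1) False]
    have dy: "d x y = Suc (d x (q ! h))" and inv': "bfs_inv R x (q' @ [y]) h"
      using disc I h'(2) y(1) by auto
    have len: "length q' < n" using bfs_inv_length[OF x inv'] by simp
    have "wp w scan_arc (\<lambda>s'' t''. vars s'' 7 = Suc (length q') \<and>
        arrs s'' 8 = (arrs s' 8)(b + y := Suc (d x y)) \<and>
        arrs s'' 9 = (arrs s' 9)(b + length q' := y) \<and> vars s'' 9 = arrs s 6 a \<and> t'' \<le> t' + 12)
        s' (t' + 1)"
      unfolding scan_arc_def
      by (rule vc_wp) (simp add: same as' Dy Du dy False word qt flip: y_def cong: vc_cong)
    then show ?thesis
    proof (rule wp_conseq, goal_cases)
      case (1 s'' t'')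
      have "bfs_state x b (q' @ [y]) s''"
        using bfs_state_snoc[of x b q' s' y s''] I False 1 by blast
      moreover have "same_outside b s s''"
        using I 1 y(2) len by (auto simp: same_outside_def)
      ultimately show ?case
        using 1 I rest inv' as'(1)
        by (intro exI[of _ "(p @ [y], as'')"]) (auto simp: g q'_def)
    qed
  qed
next
  case (4 g s' t')
  obtain p as' where g: "g = (p, as')" by fastforce
  have "as' = []" using 4(1,3) by (cases as') (auto simp: g)
  with 4(1) show ?case by (auto simp: g)
qed

text \<open>
  The queue is ordered by distance, so variable 11 ends up with the largest distance from \<open>x\<close> to a
  vertex of \<open>T\<close> (with \<open>0\<close> if there is none).
\<close>

definition max_dist :: "nat \<Rightarrow> nat list \<Rightarrow> nat \<Rightarrow> bool" where
  "max_dist x q e \<longleftrightarrow> (\<forall>v\<in>set q \<inter> T. d x v \<le> e) \<and> (e = 0 \<or> (\<exists>v\<in>set q \<inter> T. e = d x v))"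

lemma wp_expand:
  assumes x: "x < n" and b: "vars s 5 = b" and bw: "b + 2 * n + 4 < 2 ^ w"
    and h: "vars s 6 = h" "h < length q" and inv: "bfs_inv R x q h"
    and st: "bfs_state x b q s" and inp: "input s" and adj: "adj s"
    and e: "max_dist x (take h q) (vars s 11)"
  shows "wp w expand (\<lambda>s' t'. (\<exists>p. bfs_inv R x (q @ p) (Suc h) \<and> bfs_state x b (q @ p) s') \<and>
      vars s' 6 = Suc h \<and> max_dist x (take (Suc h) q) (vars s' 11) \<and> same_outside b s s' \<and>
      t' \<le> t + 20 * (1 + length (nbrs es (q ! h)))) s t"
proof -
  define u where "u = q ! h"
  have uq: "u \<in> set q" using h by (simp add: u_def)
  have ux: "u \<in> component R x" using uq inv unfolding bfs_inv_def by blast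
  have un: "u < n" "d x u < n" using component_less[OF x ux] d_less[OF x ux] .
  have Du: "arrs s 8 (b + u) = Suc (d x u)"
    using st uq un by (simp add: bfs_state_def)
  have Qh: "arrs s 9 (b + h) = u" using st h by (simp add: bfs_state_def u_def)
  have hn: "h < n" using bfs_inv_length[OF x inv] h by simp
  have word: "Suc 0 < 2 ^ w" "b + u < 2 ^ w" "b + h < 2 ^ w" "Suc h < 2 ^ w" "d x u < 2 ^ w"
    using bw un hn by linarith+
  obtain as where as: "chain (arrs s 6) (arrs s 5 u) as" "map (arrs s 7) as = rev (nbrs es u)"
    using adj unfolding adj_def adj_upto_def by blast
  have "set (map (arrs s 7) as) = {y. R u y}"
    unfolding as(2) set_rev by (rule set_nbrs_R)
  then have tgt: "arrs s 7 ` set as = {y. R u y}" by simp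
  have len: "length as = length (nbrs es u)"
    using arg_cong[OF as(2), of length] by simp
  define e' where "e' = (if u \<in> T then d x u else vars s 11)"
  \<comment> \<open>Earlier queue entries are no farther than \<open>u\<close>, so overwriting
    variable 11 by the distance of \<open>u\<close> never lowers the maximum.\<close>
  have le: "d x v \<le> d x u" if v: "v \<in> set (take h q)" for v
  proof -
    obtain i where i: "i < h" "v = q ! i" using v h(2) by (auto simp: in_set_conv_nth)
    then show ?thesis using inv h unfolding bfs_inv_def u_def
      by (auto simp: sorted_iff_nth_mono)
  qed
  have e': "max_dist x (take (Suc h) q) e'"
    using e le h(2) unfolding max_dist_def e'_def
    by (auto simp: take_Suc_conv_app_nth simp flip: u_def)
  have scan: "wp w scan (\<lambda>s' t'. vc w (Assign 6 (Op Plus (Var 6) (Const 1)))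
      (\<lambda>s'' t''. (\<exists>p. bfs_inv R x (q @ p) (Suc h) \<and> bfs_state x b (q @ p) s'') \<and>
      vars s'' 6 = Suc h \<and> max_dist x (take (Suc h) q) (vars s'' 11) \<and> same_outside b s s'' \<and>
      t'' \<le> t + 20 * (1 + length (nbrs es (q ! h)))) s' (t' + 1)) s1 t1"
    if s1: "vars s1 5 = b" "vars s1 6 = h" "vars s1 7 = vars s 7" "vars s1 8 = u" "vars s1 11 = e'"
      "vars s1 9 = arrs s 5 u" "arrs s1 = arrs s" "t1 \<le> t + 8" for s1 t1
  proof (rule wp_conseq[OF wp_scan[OF x s1(1) bw, of q h as]], goal_cases)
    case (7 s' t')
    from 7(2) obtain p where p: "bfs_inv R x (q @ p) h" "bfs_state x b (q @ p) s'"
      "\<And>y. R u y \<Longrightarrow> y \<in> set (q @ p)" "same_outside b s1 s'" "t' \<le> t1 + 15 * length as + 1"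
      unfolding u_def by blast
    have inv': "bfs_inv R x (q @ p) (Suc h)"
      by (rule bfs_inv_next) (use p h in \<open>auto simp: nth_append u_def\<close>)
    have "vars s' 6 = h" "vars s' 11 = e'"
      using s1 agree_vars[OF 7(1), of 6] agree_vars[OF 7(1), of 11]
      by (simp_all add: scan_def scan_arc_def)
    then show ?case
      using p inv' e' s1 len word
      by (auto simp: bfs_state_def same_outside_def u_def intro!: exI[of _ p])
  qed (use s1 h inv st as tgt in \<open>simp_all add: u_def bfs_state_def\<close>)
  have vc_scan: "vc w scan = wp w scan" by (intro ext) (simp add: scan_def)
  show ?thesis
  proof (rule vc_wp)
    show "vc w expand (\<lambda>s' t'. (\<exists>p. bfs_inv R x (q @ p) (Suc h) \<and> bfs_state x b (q @ p) s') \<and>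
      vars s' 6 = Suc h \<and> max_dist x (take (Suc h) q) (vars s' 11) \<and> same_outside b s s' \<and>
      t' \<le> t + 20 * (1 + length (nbrs es (q ! h)))) s t"
      unfolding expand_def using inp b h Qh Du word
      by (simp add: vc_scan input_def cong: vc_cong wp_cong flip: u_def)
         (intro conjI impI scan; simp add: e'_def)
  qed
qed

lemma wp_bfs_loop:
  assumes x: "x < n" and b: "vars s 5 = b" and bw: "b + 2 * n + 4 < 2 ^ w"
    and st: "bfs_state x b [x] s" "vars s 6 = 0" "vars s 11 = 0" and inp: "input s" and adj: "adj s"
  shows "wp w (While (Op Less (Var 6) (Var 7)) expand) (\<lambda>s' t'.
    (\<exists>q. bfs_order R x q \<and> bfs_state x b q s' \<and> max_dist x q (vars s' 11)) \<and>
    same_outside b s s' \<and> t' \<le> t + 88 * m + 30) s t"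
proof (rule wp_While[where g = "([x], 0)" and f = "\<lambda>(q, h). n - h" and
    I = "\<lambda>(q, h) s' t'. bfs_inv R x q h \<and> vars s' 6 = h \<and> bfs_state x b q s' \<and>
      max_dist x (take h q) (vars s' 11) \<and> same_outside b s s' \<and> t' \<le> t + 22 * work (take h q)"],
    goal_cases)
  case 1
  show ?case
    using st bfs_inv_init by (simp add: max_dist_def same_outside_def)
next
  case (2 g s' t')
  show ?case using word_bounds by simp
next
  case (3 g s' t')
  obtain q h where g: "g = (q, h)" by fastforce
  note I = 3(1)[unfolded g prod.case]
  have h: "vars s' 6 = h" "h < length q"
    using I 3(3) by (auto simp: bfs_state_def split: if_splits)
  have inp': "input s'" and adj': "adj s'"
    by (rule input_agree[OF 3(2) inp] adj_agree[OF 3(2) adj];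
        simp add: expand_def scan_def scan_arc_def)+
  have b': "vars s' 5 = b"
    using b agree_vars[OF 3(2), of 5] by (simp add: expand_def scan_def scan_arc_def)
  have len: "length q \<le> n" using I bfs_inv_length[OF x] by blast
  show ?case
  proof (rule wp_conseq[OF wp_expand[OF x b' bw h _ _ inp' adj']], goal_cases)
    case (4 s'' t'')
    from 4(2) obtain p where "bfs_inv R x (q @ p) (Suc h)" "bfs_state x b (q @ p) s''" by blast
    with 4(2) I h len show ?case
      by (intro exI[of _ "(q @ p, Suc h)"])
         (auto simp: g same_outside_def work_def take_Suc_conv_app_nth)
  qed (use I in auto)
next
  case (4 g s' t')
  obtain q h where g: "g = (q, h)" by fastforce
  note I = 4(1)[unfolded g prod.case]
  have h: "h = length q"
    using I 4(3) by (auto simp: bfs_state_def bfs_inv_def split: if_splits)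
  have q: "bfs_order R x q" using I h bfs_inv_finish[of R x q] by simp
  \<comment> \<open>An expansion costs 20 steps per unit of \<open>work\<close>, and the loop test
    and sequencing fit into two more; 22 times this bound gives the \<open>88 * m\<close>.\<close>
  then have "work q \<le> 4 * m + 1" by (intro work_le[OF x]) (auto simp: bfs_order_def)
  with I h q show ?case by auto
qed

lemma wp_bfs:
  assumes x: "vars s 2 = x" "x < n" and b: "vars s 5 = b" and bw: "b + 2 * n + 4 < 2 ^ w"
    and inp: "input s" and adj: "adj s" and fresh: "\<And>y. y < n \<Longrightarrow> arrs s 8 (b + y) = 0"
  shows "wp w bfs (\<lambda>s' t'.
    (\<exists>q. bfs_order R x q \<and> bfs_state x b q s' \<and> max_dist x q (vars s' 11)) \<and>
    same_outside b s s' \<and> t' \<le> t + 88 * m + 50) s t"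
proof -
  define s1 where "s1 = set_var 11 0 (set_var 7 1 (set_var 6 0 (set_arr 9 b x (set_arr 8 (b + x) 1 s))))"
  have loop: "wp w (While (Op Less (Var 6) (Var 7)) expand) (\<lambda>s' t'.
    (\<exists>q. bfs_order R x q \<and> bfs_state x b q s' \<and> max_dist x q (vars s' 11)) \<and>
    same_outside b s s' \<and> t' \<le> t + 88 * m + 50) s1 t1"
    if "t1 \<le> t + 10" for t1
  proof (rule wp_conseq[OF wp_bfs_loop[OF x(2) _ bw]], goal_cases)
    case (7 s' t')
    then show ?case using x(2) that by (auto simp: s1_def same_outside_def)
  next
    case 5
    show ?case using inp by (simp add: input_def s1_def)
  next
    case 6
    show ?case using adj by (simp add: adj_def s1_def)
  qed (use b fresh in \<open>auto simp: s1_def bfs_state_def\<close>)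
  have word: "1 < (2::nat) ^ w" "b + x < 2 ^ w" using bw x by linarith+
  show ?thesis
    unfolding bfs_def
    by (rule vc_wp) (use loop x b word in \<open>simp add: s1_def cong: vc_cong wp_cong\<close>)
qed

lemma vc_raise:
  assumes "fits w e s"
  shows "vc w (raise a e) Q s t \<longleftrightarrow>
    Q (set_arr a (vars s 8) (max (arrs s a (vars s 8)) (val e s)) s) (t + 2)"
proof -
  have "Suc 0 < 2 ^ w" using word_bounds by linarith
  with assms show ?thesis unfolding raise_def by (auto simp: max_def cong: vc_cong)
qed

lemma wp_update_vertex:
  assumes x: "vars s 2 = x" "x < n" and b: "vars s 5 = b" and bw: "b + 2 * n + 4 < 2 ^ w"
    and h: "vars s 6 = h" "h < length q" and q: "bfs_order R x q" and st: "bfs_state x b q s"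
    and inp: "input s" and e: "vars s 11 = e" "e < 2 ^ w"
  defines "u \<equiv> q ! h"
  defines "M \<equiv> max (arrs s 10 u) (n - d x u)"
  shows "wp w update_vertex (\<lambda>s' t'. vars s' 6 = Suc h \<and>
    arrs s' 4 = (arrs s 4)(u := max (arrs s 4 u) (max (e - d x u) (if x \<in> T then d x u else 0))) \<and>
    arrs s' 10 = (arrs s 10)(u := M) \<and>
    vars s' 17 = (if u \<in> T \<and> M < vars s 17 then M else vars s 17) \<and>
    vars s' 16 = (if u \<in> T \<and> M < vars s 17 then u else vars s 16) \<and> t' \<le> t + 30) s t"
proof -
  have uq: "u \<in> set q" using h by (simp add: u_def)
  have ux: "u \<in> component R x" using uq q unfolding bfs_order_def by blast
  have un: "u < n" "d x u < n" using component_less[OF x(2) ux] d_less[OF x(2) ux] .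
  have Du: "arrs s 8 (b + u) = Suc (d x u)"
    using st uq un by (simp add: bfs_state_def)
  have Qh: "arrs s 9 (b + h) = u" using st h by (simp add: bfs_state_def u_def)
  have "set q \<subseteq> {..<n}"
    using q component_less[OF x(2)] unfolding bfs_order_def by blast
  then have "card (set q) \<le> n" by (metis card_lessThan card_mono finite_lessThan)
  then have "length q \<le> n" using distinct_card[of q] q unfolding bfs_order_def by metis
  then have hn: "h < n" using h(2) by simp
  have word: "Suc 0 < 2 ^ w" "b + u < 2 ^ w" "b + h < 2 ^ w" "Suc h < 2 ^ w" "d x u < 2 ^ w"
    "n - d x u < 2 ^ w" "e - d x u < 2 ^ w"
    using bw un hn e(2) by linarith+
  have n0: "vars s 0 = n" and in_T: "arrs s 3 x = of_bool (x \<in> T)" "arrs s 3 u = of_bool (u \<in> T)"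
    using inp by (simp_all add: input_def)
  show ?thesis
    unfolding update_vertex_def
    by (rule vc_wp, cases "x \<in> T"; cases "u \<in> T"; cases "M < vars s 17";
        simp add: in_T n0 x(1) b h(1) Qh Du word e(1) vc_raise max.assoc cong: vc_cong flip: M_def)
qed

lemma wp_update:
  assumes x: "vars s 2 = x" "x < n" and b: "vars s 5 = b" and bw: "b + 2 * n + 4 < 2 ^ w"
    and q: "bfs_order R x q" and st: "bfs_state x b q s"
    and inp: "input s" and e: "vars s 11 = e" "e < 2 ^ w" and M: "\<And>v. v \<in> set q \<Longrightarrow> arrs s 10 v \<le> n"
  shows "wp w update (\<lambda>s' t'.
    (\<forall>v\<in>set q. arrs s' 4 v = max (arrs s 4 v) (max (e - d x v) (if x \<in> T then d x v else 0)) \<and>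
       arrs s' 10 v = max (arrs s 10 v) (n - d x v)) \<and>
    (T \<inter> set q \<noteq> {} \<longrightarrow> vars s' 16 \<in> T \<inter> set q \<and>
       (\<forall>v\<in>T \<inter> set q. arrs s' 10 (vars s' 16) \<le> arrs s' 10 v)) \<and>
    t' \<le> t + 64 * m + 50) s t"
proof -
  define F where "F = (\<lambda>v. max (arrs s 4 v) (max (e - d x v) (if x \<in> T then d x v else 0)))"
  define G where "G = (\<lambda>v. max (arrs s 10 v) (n - d x v))"
  define Q where "Q = (\<lambda>s' (t' :: nat). (\<forall>v\<in>set q. arrs (s' :: state) 4 v = F v \<and> arrs s' 10 v = G v) \<and>
    (T \<inter> set q \<noteq> {} \<longrightarrow> vars s' 16 \<in> T \<inter> set q \<and>
       (\<forall>v\<in>T \<inter> set q. arrs s' 10 (vars s' 16) \<le> arrs s' 10 v)) \<and>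
    t' \<le> t + 64 * m + 50)"
  \<comment> \<open>With at most 32 steps per vertex, this length accounts for the
    \<open>64 * m\<close> of the bound.\<close>
  have dist: "distinct q" and len: "length q \<le> 2 * m + 1"
    using q work_le(2)[OF x(2)] by (auto simp: bfs_order_def)
  have Gn: "G v \<le> n" if "v \<in> set q" for v using M that by (simp add: G_def)
  define s1 where "s1 = set_var 17 (Suc n) (set_var 6 0 s)"
  have loop: "wp w (While (Op Less (Var 6) (Var 7)) update_vertex) Q s1 t1" if "t1 \<le> t + 5" for t1
  proof (rule wp_While[where g = 0 and f = "\<lambda>h. length q - h" and
      I = "\<lambda>h s' t'. vars s' 6 = h \<and> h \<le> length q \<and>
        (\<forall>v. arrs s' 4 v = (if v \<in> set (take h q) then F v else arrs s 4 v)) \<and>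
        (\<forall>v. arrs s' 10 v = (if v \<in> set (take h q) then G v else arrs s 10 v)) \<and>
        (\<forall>v\<in>T \<inter> set (take h q). vars s' 17 \<le> G v) \<and>
        (vars s' 17 = Suc n \<or>
          vars s' 16 \<in> T \<inter> set (take h q) \<and> G (vars s' 16) = vars s' 17) \<and>
        t' \<le> t + 5 + 32 * h"], goal_cases)
    case 1
    show ?case using that by (simp add: s1_def)
  next
    case (2 h s' t')
    show ?case using word_bounds by simp
  next
    case (3 h s' t')
    have agr: "vars s' 2 = x" "vars s' 5 = b" "bfs_state x b q s'" "input s'" "vars s' 11 = e"
      using 3(2) x b e st inp by (auto simp: agree_def update_vertex_def raise_def s1_def bfs_state_def input_def)
    have h: "vars s' 6 = h" "h < length q"
      using 3 agr(3) by (auto simp: bfs_state_def split: if_splits)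
    define u where "u = q ! h"
    have u: "u \<notin> set (take h q)" "u \<in> set q"
      using h(2) dist unfolding u_def
      by (auto simp: in_set_conv_nth nth_eq_iff_index_eq)
    have tk: "set (take (Suc h) q) = insert u (set (take h q))"
      using h(2) by (simp add: take_Suc_conv_app_nth u_def)
    have max: "max (arrs s' 10 u) (n - d x u) = G u"
      "max (arrs s' 4 u) (max (e - d x u) (if x \<in> T then d x u else 0)) = F u"
      using 3(1) u by (simp_all add: G_def F_def)
    show ?case
    proof (rule wp_conseq[OF wp_update_vertex[OF agr(1) x(2) agr(2) bw h q agr(3,4,5) e(2)]], goal_cases)
      case (1 s'' t'')
      note P = 1(2)[folded u_def, unfolded max]
      have "vars s'' 17 \<le> vars s' 17" using P by (auto split: if_splits)
      then have min: "\<forall>v\<in>T \<inter> set (take h q). vars s'' 17 \<le> G v"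
        using 3(1) by (meson order_trans)
      show ?case
        using P 3(1) h(2) Gn[OF u(2)] min
        by (intro exI[of _ "Suc h"]) (auto simp: tk)
    qed
  next
    case (4 h s' t')
    have "vars s' 7 = length q"
      using agree_vars[OF 4(2), of 7] st
      by (simp add: update_vertex_def raise_def s1_def bfs_state_def)
    then have h: "h = length q" using 4 by (auto split: if_splits)
    \<comment> \<open>Once a vertex of \<open>T\<close> has been met, variable 17 is at most
      \<open>n\<close>; this excludes the initial value \<open>n + 1\<close>, and variable 16 is
      meaningful.\<close>
    have "vars s' 16 \<in> T \<inter> set q \<and> G (vars s' 16) = vars s' 17" if "T \<inter> set q \<noteq> {}"
    proof -
      obtain v where "v \<in> T \<inter> set q" using \<open>T \<inter> set q \<noteq> {}\<close> by blast
      then have "vars s' 17 \<le> n" using 4(1) Gn[of v] h by force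
      then show ?thesis using 4(1) h by auto
    qed
    then show ?case using 4(1) h len by (auto simp: Q_def)
  qed
  have word: "Suc n < 2 ^ w" "0 < (2::nat) ^ w" "Suc 0 < 2 ^ w" using bw by linarith+
  have "wp w update Q s t"
    unfolding update_def
    by (rule vc_wp) (use loop inp word in \<open>simp add: s1_def input_def cong: vc_cong wp_cong\<close>)
  then show ?thesis unfolding Q_def F_def G_def .
qed

end

section \<open>Searches from the centres and from the vertices of one ball\<close>

definition explore :: com where
  "explore = bfs ;; update"

text \<open>A queue with at most \<open>r\<close> entries has no entry at index \<open>r\<close>.
  Nothing is recorded in that case, and variable 15 keeps the address \<open>0\<close> of the first
  queue, whose first \<open>r\<close> entries are then the whole component.\<close>

definition remember_best :: com where
  "remember_best =
     If (Op Less (Var 13) (Var 7))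
       (Assign 12 (Read 8 (Op Plus (Var 5) (Read 9 (Op Plus (Var 5) (Var 13))))) ;;
        If (Op Less (Var 14) (Var 12)) (Assign 14 (Var 12) ;; Assign 15 (Var 5)) Skip) Skip"

definition greedy_step :: com where
  "greedy_step =
     explore ;;
     remember_best ;;
     Assign 2 (Var 16) ;;
     Assign 5 (Op Plus (Var 5) (Var 0)) ;;
     Assign 4 (Op Plus (Var 4) (Const 1))"

definition greedy_phase :: com where
  "greedy_phase = While (Op Less (Var 4) (Var 13)) greedy_step"

definition ball_step :: com where
  "ball_step =
     Assign 2 (Read 9 (Op Plus (Var 15) (Var 4))) ;;
     explore ;;
     Assign 5 (Op Plus (Var 5) (Var 0)) ;;
     Assign 4 (Op Plus (Var 4) (Const 1))"

text \<open>The product of truth values is a conjunction. Each search overwrites variable 7, but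
  with the same number, since all sources lie in one component.\<close>

definition ball_phase :: com where
  "ball_phase = While (Op Times (Op Less (Var 4) (Var 13)) (Op Less (Var 4) (Var 7))) ball_step"

lemmas com_defs = explore_def bfs_def expand_def scan_def scan_arc_def update_def update_vertex_def
  raise_def remember_best_def greedy_step_def ball_step_def

text \<open>The inequalities determine \<open>r\<close> as the integer square root of
  \<open>n\<close> plus one: the first serves the packing argument, the second limits the number of
  searches.\<close>

locale st_search = st_instance +
  fixes t0 r :: nat
  assumes t0: "t0 \<in> T" and r: "n < r * r" "(r - 1) * (r - 1) \<le> n"
begin

definition A :: "nat set" where
  "A = component R t0"

text \<open>Each centre maximizes, over \<open>T \<inter> A\<close>, the distance to the nearest
  earlier centre; the quantifiers compare the two minima without naming them.\<close>

definition greedy :: "nat list \<Rightarrow> bool" where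
  "greedy ws \<longleftrightarrow> (\<forall>i<length ws. 0 < i \<longrightarrow>
     (\<forall>t\<in>T \<inter> A. \<exists>j<i. \<forall>l<i. d (ws ! j) t \<le> d (ws ! l) (ws ! i)))"

text \<open>The first part bounds the estimate by the eccentricity within \<open>A\<close>. The
  second says that every source in \<open>X\<close> has contributed its lower bounds, written with a
  sum because subtraction on \<open>nat\<close> is truncated.\<close>

definition est_ok :: "nat set \<Rightarrow> state \<Rightarrow> bool" where
  "est_ok X s \<longleftrightarrow> (\<forall>v\<in>A. (\<exists>t\<in>T \<inter> A. arrs s 4 v \<le> d v t) \<and>
     (\<forall>x\<in>X. (\<forall>t\<in>T \<inter> A. d x t \<le> arrs s 4 v + d x v) \<and> (x \<in> T \<longrightarrow> d x v \<le> arrs s 4 v)))"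

text \<open>Storing \<open>n - d\<close> turns the minimum of distances into a maximum and lets the
  zero of fresh memory stand for an infinite distance; genuine values are positive inside
  \<open>A\<close>.\<close>

definition far_ok :: "nat set \<Rightarrow> state \<Rightarrow> bool" where
  "far_ok X s \<longleftrightarrow> (\<forall>v\<in>A. (\<forall>x\<in>X. n - d x v \<le> arrs s 10 v) \<and>
     (arrs s 10 v = 0 \<or> (\<exists>x\<in>X. arrs s 10 v = n - d x v)))"

lemma A_less: "x \<in> A \<Longrightarrow> x < n"
  using component_less t0 T unfolding A_def by blast

lemma finite_A: "finite A"
  using A_less by (auto intro: finite_subset[of _ "{..<n}"])

lemma card_A: "card A \<le> n"
  using A_less card_mono[of "{..<n}" A] by auto

lemma component_A: "x \<in> A \<Longrightarrow> component R x = A"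
  unfolding A_def by (rule component_eq[OF sym])

lemma t0_A: "t0 \<in> T \<inter> A"
  using t0 by (simp add: A_def)

lemma d_A: "x \<in> A \<Longrightarrow> y \<in> A \<Longrightarrow> d x y < n"
  using d_less A_less component_A by blast

lemma triangle_A: "x \<in> A \<Longrightarrow> y \<in> A \<Longrightarrow> z \<in> A \<Longrightarrow> d x z \<le> d x y + d y z"
  using dst_triangle component_A by metis

lemma r_bounds: "1 \<le> r" "r \<le> n + 1" "card A < r * (r + 1)"
proof -
  show "1 \<le> r" using r(1) by (cases r) auto
  show "r \<le> n + 1"
  proof (rule ccontr)
    assume "\<not> r \<le> n + 1"
    then have "n + 1 \<le> r - 1" by simp
    then have "(n + 1) * (n + 1) \<le> (r - 1) * (r - 1)" by (rule mult_le_mono) fact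
    with r(2) show False by simp
  qed
  show "card A < r * (r + 1)" using card_A r(1) by simp
qed

lemma bfs_order_A: "x \<in> A \<Longrightarrow> bfs_order R x q \<Longrightarrow> set q = A \<and> length q = card A"
  using component_A by (metis bfs_order_def distinct_card)

lemma base_bound:
  assumes "b \<le> 2 * r * n"
  shows "b + 2 * n + 4 < 2 ^ w"
proof -
  have "2 * r * n \<le> 2 * (n + 1) * n" using r_bounds(2) by (intro mult_le_mono) auto
  with assms word_bounds show ?thesis by (simp add: algebra_simps)
qed

text \<open>If \<open>e\<close> is attained at \<open>u\<close>, the triangle inequality gives
  \<open>e - d x v \<le> d v u\<close>; for \<open>e = 0\<close> the vertex \<open>t0\<close> is a
  witness. For \<open>x\<close> in \<open>T\<close> the bound \<open>d x v\<close> is witnessed by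
  \<open>x\<close> itself.\<close>

lemma est_ok_insert:
  assumes x: "x \<in> A" and est: "est_ok X s" and e: "max_dist x q e" and q: "set q = A"
    and upd: "\<And>v. v \<in> A \<Longrightarrow>
      arrs s' 4 v = max (arrs s 4 v) (max (e - d x v) (if x \<in> T then d x v else 0))"
  shows "est_ok (insert x X) s'"
  unfolding est_ok_def
proof (intro ballI conjI)
  fix v assume v: "v \<in> A"
  from est v obtain t where t: "t \<in> T \<inter> A" "arrs s 4 v \<le> d v t" unfolding est_ok_def by blast
  have "\<exists>t\<in>T \<inter> A. e - d x v \<le> d v t"
  proof (cases "e = 0")
    case False
    then obtain u where u: "u \<in> T \<inter> A" "e = d x u" using e q unfolding max_dist_def by blast
    then have "e - d x v \<le> d v u" using triangle_A[OF x v, of u] by simp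
    with u show ?thesis by blast
  qed (use t0_A in auto)
  then obtain u where u: "u \<in> T \<inter> A" "e - d x v \<le> d v u" by blast
  show "\<exists>t\<in>T \<inter> A. arrs s' 4 v \<le> d v t"
  proof (cases "x \<in> T")
    case True
    have "arrs s' 4 v \<le> max (d v t) (max (d v u) (d v x))"
      using t u upd[OF v] True dst_sym[OF sym, of x v] by (auto simp: max_def)
    with t u True x show ?thesis by (auto simp: max_def split: if_splits)
  next
    case False
    have "arrs s' 4 v \<le> max (d v t) (d v u)"
      using t u upd[OF v] False by (auto simp: max_def)
    with t u show ?thesis by (auto simp: max_def split: if_splits)
  qed
  fix y assume "y \<in> insert x X"
  then show "y \<in> T \<longrightarrow> d y v \<le> arrs s' 4 v"
    using upd[OF v] est v unfolding est_ok_def by (auto simp: le_max_iff_disj)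
  fix t assume t: "t \<in> T \<inter> A"
  show "d y t \<le> arrs s' 4 v + d y v"
  proof (cases "y \<in> X")
    case True
    then have "d y t \<le> arrs s 4 v + d y v" using est v t unfolding est_ok_def by blast
    then show ?thesis using upd[OF v] by linarith
  next
    case False
    then have "d y t \<le> e" using \<open>y \<in> insert x X\<close> e q t unfolding max_dist_def by blast
    then show ?thesis using upd[OF v] False \<open>y \<in> insert x X\<close> by auto
  qed
qed

lemma far_ok_insert:
  assumes "x \<in> A" and "far_ok X s" and upd: "\<And>v. v \<in> A \<Longrightarrow> arrs s' 10 v = max (arrs s 10 v) (n - d x v)"
  shows "far_ok (insert x X) s'"
  unfolding far_ok_def
proof (intro ballI conjI)
  fix v assume v: "v \<in> A"
  show "n - d y v \<le> arrs s' 10 v" if "y \<in> insert x X" for y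
    using that assms(2) v unfolding far_ok_def by (auto simp: upd le_max_iff_disj)
  show "arrs s' 10 v = 0 \<or> (\<exists>x\<in>insert x X. arrs s' 10 v = n - d x v)"
    using assms(2) v unfolding far_ok_def by (auto simp: upd max_def)
qed

lemma wp_explore:
  assumes x: "vars s 2 = x" "x \<in> A" and b: "vars s 5 = b" "b \<le> 2 * r * n"
    and inp: "input s" and adj: "adj s" and fresh: "\<And>y. y < n \<Longrightarrow> arrs s 8 (b + y) = 0"
    and est: "est_ok X s" and far: "far_ok X s"
  shows "wp w explore (\<lambda>s' t'.
    (\<exists>q. bfs_order R x q \<and> bfs_state x b q s') \<and> same_outside b s s' \<and>
    est_ok (insert x X) s' \<and> far_ok (insert x X) s' \<and>
    vars s' 16 \<in> T \<inter> A \<and> (\<forall>v\<in>T \<inter> A. arrs s' 10 (vars s' 16) \<le> arrs s' 10 v) \<and>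
    t' \<le> t + 152 * m + 110) s t"
  unfolding explore_def
proof (rule wp_Seq, rule wp_conseq[OF wp_bfs[OF x(1) A_less[OF x(2)] b(1) base_bound[OF b(2)] inp adj fresh]], assumption)
  fix s1 t1
  assume agr: "agree bfs s s1" and "(\<exists>q. bfs_order R x q \<and> bfs_state x b q s1 \<and> max_dist x q (vars s1 11)) \<and>
    same_outside b s s1 \<and> t1 \<le> t + 88 * m + 50"
  then obtain q where q: "bfs_order R x q" "bfs_state x b q s1" "max_dist x q (vars s1 11)"
    and s1: "same_outside b s s1" "t1 \<le> t + 88 * m + 50" by blast
  have qA: "set q = A" using bfs_order_A[OF x(2) q(1)] by simp
  have same: "vars s1 2 = x" "vars s1 5 = b" "input s1" "arrs s1 4 = arrs s 4" "arrs s1 10 = arrs s 10"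
    using agr x b inp by (auto simp: agree_def com_defs input_def)
  have en: "vars s1 11 < 2 ^ w"
  proof -
    have "vars s1 11 < n"
      using q(3) d_A[OF x(2)] n unfolding max_dist_def qA by auto
    then show ?thesis using word_bounds by linarith
  qed
  have Mn: "arrs s1 10 v \<le> n" if "v \<in> set q" for v
    using far that unfolding far_ok_def same qA by fastforce
  show "wp w update (\<lambda>s' t'.
    (\<exists>q. bfs_order R x q \<and> bfs_state x b q s') \<and> same_outside b s s' \<and>
    est_ok (insert x X) s' \<and> far_ok (insert x X) s' \<and>
    vars s' 16 \<in> T \<inter> A \<and> (\<forall>v\<in>T \<inter> A. arrs s' 10 (vars s' 16) \<le> arrs s' 10 v) \<and>
    t' \<le> t + 152 * m + 110) s1 (t1 + 1)"
  proof (rule wp_conseq[OF wp_update[OF same(1) A_less[OF x(2)] same(2) base_bound[OF b(2)] q(1,2) same(3) refl en Mn]],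
      assumption)
    fix s2 t2
    assume agr2: "agree update s1 s2" and P: "(\<forall>v\<in>set q. arrs s2 4 v =
        max (arrs s1 4 v) (max (vars s1 11 - d x v) (if x \<in> T then d x v else 0)) \<and>
        arrs s2 10 v = max (arrs s1 10 v) (n - d x v)) \<and>
      (T \<inter> set q \<noteq> {} \<longrightarrow> vars s2 16 \<in> T \<inter> set q \<and>
        (\<forall>v\<in>T \<inter> set q. arrs s2 10 (vars s2 16) \<le> arrs s2 10 v)) \<and> t2 \<le> t1 + 1 + 64 * m + 50"
    have "vars s2 7 = vars s1 7" "arrs s2 8 = arrs s1 8" "arrs s2 9 = arrs s1 9"
      using agr2 by (auto simp: agree_def com_defs)
    then have "bfs_state x b q s2" "same_outside b s s2"
      using q(2) s1(1) by (simp_all add: bfs_state_def same_outside_def)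
    moreover have "est_ok (insert x X) s2"
      using P same by (intro est_ok_insert[OF x(2) est q(3) qA]) (simp add: qA)
    moreover have "far_ok (insert x X) s2"
      using P same by (intro far_ok_insert[OF x(2) far]) (simp add: qA)
    ultimately show "(\<exists>q. bfs_order R x q \<and> bfs_state x b q s2) \<and> same_outside b s s2 \<and>
      est_ok (insert x X) s2 \<and> far_ok (insert x X) s2 \<and>
      vars s2 16 \<in> T \<inter> A \<and> (\<forall>v\<in>T \<inter> A. arrs s2 10 (vars s2 16) \<le> arrs s2 10 v) \<and>
      t2 \<le> t + 152 * m + 110"
      using q(1) P s1(2) t0_A unfolding qA by auto
  qed
qed

text \<open>
  Variable 15 points to the queue of the search from \<open>ws ! z\<close>, the centre for which the \<open>r\<close>-th entry
  of the queue is farthest away.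
\<close>

definition best_ok :: "nat list \<Rightarrow> state \<Rightarrow> bool" where
  "best_ok ws s \<longleftrightarrow>
     (if ws = [] then vars s 14 = 0 \<and> vars s 15 = 0
      else (\<exists>z<length ws. \<exists>q. vars s 15 = z * n \<and> bfs_order R (ws ! z) q \<and>
              (\<forall>j<length q. arrs s 9 (z * n + j) = q ! j) \<and>
              (r < card A \<longrightarrow> vars s 14 = Suc (d (ws ! z) (q ! r)))) \<and>
           (\<forall>c\<in>set ws. \<forall>a. r < card A \<and> card {y \<in> A. d c y \<le> a} \<le> r \<longrightarrow> Suc a < vars s 14))"

lemma best_ok_snoc:
  assumes x: "x \<in> A" and best: "best_ok ws s" and q: "bfs_order R x q" and ws: "set ws \<subseteq> A"
    and Q: "\<And>j. j < length q \<Longrightarrow> arrs s' 9 (length ws * n + j) = q ! j"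
    and old: "\<And>j. j < length ws * n \<Longrightarrow> arrs s' 9 j = arrs s 9 j"
    and upd: "vars s' 14 = (if r < card A \<and> vars s 14 < Suc (d x (q ! r)) then Suc (d x (q ! r)) else vars s 14)"
      "vars s' 15 = (if r < card A \<and> vars s 14 < Suc (d x (q ! r)) then length ws * n else vars s 15)"
  shows "best_ok (ws @ [x]) s'"
proof -
  have lenq: "length q = card A" using bfs_order_A[OF x q] by simp
  have new: "r < card A \<and> card {y \<in> A. d x y \<le> a} \<le> r \<longrightarrow> Suc a < vars s' 14" for a
    using bfs_order_ball[OF q, of r a] upd(1) component_A[OF x] lenq by auto
  have "\<forall>c\<in>set ws. \<forall>a. r < card A \<and> card {y \<in> A. d c y \<le> a} \<le> r \<longrightarrow> Suc a < vars s' 14"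
  proof (intro ballI allI impI)
    fix c a assume "c \<in> set ws" "r < card A \<and> card {y \<in> A. d c y \<le> a} \<le> r"
    with best have "Suc a < vars s 14" unfolding best_ok_def by (auto split: if_splits)
    with upd(1) show "Suc a < vars s' 14" by (auto split: if_splits)
  qed
  moreover have "\<exists>z<length (ws @ [x]). \<exists>q. vars s' 15 = z * n \<and> bfs_order R ((ws @ [x]) ! z) q \<and>
      (\<forall>j<length q. arrs s' 9 (z * n + j) = q ! j) \<and>
      (r < card A \<longrightarrow> vars s' 14 = Suc (d ((ws @ [x]) ! z) (q ! r)))"
  proof (cases "ws = [] \<or> r < card A \<and> vars s 14 < Suc (d x (q ! r))")
    case True
    \<comment> \<open>For the first centre the pointer may be left unassigned, namely if
      \<open>card A \<le> r\<close>; its initial value \<open>0\<close> is then the right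
      address.\<close>
    then have "vars s' 15 = length ws * n" "r < card A \<longrightarrow> vars s' 14 = Suc (d x (q ! r))"
      using upd best by (auto simp: best_ok_def)
    with q Q show ?thesis by (intro exI[of _ "length ws"] conjI exI[of _ q]) auto
  next
    case False
    then obtain z q' where z: "z < length ws" "vars s 15 = z * n" "bfs_order R (ws ! z) q'"
      "\<And>j. j < length q' \<Longrightarrow> arrs s 9 (z * n + j) = q' ! j"
      "r < card A \<longrightarrow> vars s 14 = Suc (d (ws ! z) (q' ! r))"
      using best unfolding best_ok_def by auto
    have "ws ! z \<in> A" using z ws by auto
    then have len: "length q' \<le> n" using bfs_order_A z(3) card_A by metis
    have "z * n + j < length ws * n" if "j < length q'" for j
    proof -
      have "z * n + j < Suc z * n" using that len by simp
      also have "\<dots> \<le> length ws * n" using z(1) by (intro mult_le_mono1) simp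
      finally show ?thesis .
    qed
    then have "arrs s' 9 (z * n + j) = q' ! j" if "j < length q'" for j
      using that old z(4) by simp
    moreover have "vars s' 14 = vars s 14" "vars s' 15 = vars s 15"
      using False upd by auto
    ultimately show ?thesis
      using z by (intro exI[of _ z] conjI exI[of _ q']) (auto simp: nth_append)
  qed
  ultimately show ?thesis using new by (simp add: best_ok_def)
qed

text \<open>A smallest entry of array 10 over \<open>T \<inter> A\<close> belongs to a vertex whose
  nearest centre is as far away as possible.\<close>

lemma greedy_snoc:
  assumes "greedy ws" and ws: "set ws \<subseteq> A" and x: "x \<in> A" and far: "far_ok (set ws) s"
    and max: "ws \<noteq> [] \<longrightarrow> (\<forall>v\<in>T \<inter> A. arrs s 10 x \<le> arrs s 10 v)"
  shows "greedy (ws @ [x])"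
  unfolding greedy_def
proof (intro allI impI ballI)
  fix i t assume i: "i < length (ws @ [x])" "0 < i" and t: "t \<in> T \<inter> A"
  show "\<exists>j<i. \<forall>l<i. d ((ws @ [x]) ! j) t \<le> d ((ws @ [x]) ! l) ((ws @ [x]) ! i)"
  proof (cases "i < length ws")
    case True
    then obtain j where "j < i" "\<forall>l<i. d (ws ! j) t \<le> d (ws ! l) (ws ! i)"
      using assms(1) i t unfolding greedy_def by blast
    then show ?thesis using True by (intro exI[of _ j]) (auto simp: nth_append)
  next
    case False
    then have iw: "i = length ws" "ws \<noteq> []" using i by auto
    have lower: "n - d c v \<le> arrs s 10 v" if "c \<in> set ws" "v \<in> A" for c v
      using far that unfolding far_ok_def by blast
    \<comment> \<open>Positivity excludes the default \<open>0\<close>, so the entry of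
      \<open>t\<close> comes from an actual nearest centre.\<close>
    have "0 < arrs s 10 t"
      using lower[of "hd ws" t] d_A[of "hd ws" t] iw(2) ws t hd_in_set[of ws] by fastforce
    then obtain c where c: "c \<in> set ws" "arrs s 10 t = n - d c t"
      using far t unfolding far_ok_def by fastforce
    have "d c t \<le> d u x" if "u \<in> set ws" for u
    proof -
      have "arrs s 10 x \<le> arrs s 10 t" using max iw(2) t by blast
      with lower[OF that x] c(2) have "n - d u x \<le> n - d c t" by simp
      \<comment> \<open>Without this the truncated differences could agree at \<open>0\<close> and
        lose the comparison of distances.\<close>
      moreover have "d c t < n" using d_A c(1) ws t by blast
      ultimately show ?thesis by linarith
    qed
    moreover obtain j where "j < length ws" "ws ! j = c" using c(1) by (metis in_set_conv_nth)
    ultimately show ?thesis using iw(1)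
      by (intro exI[of _ j]) (auto simp: nth_append)
  qed
qed

text \<open>The last clause concerns the first search, whose block starts at cell \<open>0\<close>:
  it remains as a membership test for \<open>A\<close> when the final estimates are written.\<close>

definition greedy_inv :: "nat list \<Rightarrow> state \<Rightarrow> bool" where
  "greedy_inv ws s \<longleftrightarrow> vars s 4 = length ws \<and> length ws \<le> r \<and> vars s 5 = length ws * n \<and>
     vars s 2 \<in> T \<inter> A \<and> set ws \<subseteq> T \<inter> A \<and> est_ok (set ws) s \<and> far_ok (set ws) s \<and>
     (ws \<noteq> [] \<longrightarrow> (\<forall>v\<in>T \<inter> A. arrs s 10 (vars s 2) \<le> arrs s 10 v)) \<and>
     greedy ws \<and> (\<forall>z\<ge>length ws * n. arrs s 8 z = 0) \<and> best_ok ws s \<and>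
     (ws \<noteq> [] \<longrightarrow> vars s 7 = card A \<and> (\<forall>y<n. arrs s 8 y = 0 \<longleftrightarrow> y \<notin> A))"

lemma wp_greedy_step:
  assumes inv: "greedy_inv ws s" and len: "length ws < r" and inp: "input s" and adj: "adj s"
    and r13: "vars s 13 = r"
  shows "wp w greedy_step (\<lambda>s' t'. greedy_inv (ws @ [vars s 2]) s' \<and> t' \<le> t + 152 * m + 140) s t"
proof -
  define x where "x = vars s 2"
  define b where "b = length ws * n"
  have x: "x \<in> A" "x \<in> T" and b: "vars s 5 = b" using inv by (simp_all add: greedy_inv_def x_def b_def)
  have b_le: "b + n \<le> 2 * r * n"
  proof -
    have "b + n = Suc (length ws) * n" by (simp add: b_def)
    also have "\<dots> \<le> 2 * r * n" using len by (intro mult_le_mono1) simp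
    finally show ?thesis .
  qed
  have fresh: "arrs s 8 (b + y) = 0" for y using inv by (simp add: greedy_inv_def b_def)
  have est: "est_ok (set ws) s" and far: "far_ok (set ws) s" using inv by (simp_all add: greedy_inv_def)
  show ?thesis
    unfolding greedy_step_def
  proof (rule wp_Seq, rule wp_conseq[OF wp_explore[OF x_def[symmetric] x(1) b _ inp adj fresh est far]])
    show "b \<le> 2 * r * n" using b_le by simp
    fix s1 t1
    assume agr: "agree explore s s1" and "(\<exists>q. bfs_order R x q \<and> bfs_state x b q s1) \<and>
      same_outside b s s1 \<and> est_ok (insert x (set ws)) s1 \<and> far_ok (insert x (set ws)) s1 \<and>
      vars s1 16 \<in> T \<inter> A \<and> (\<forall>v\<in>T \<inter> A. arrs s1 10 (vars s1 16) \<le> arrs s1 10 v) \<and>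
      t1 \<le> t + 152 * m + 110"
    then obtain q where q: "bfs_order R x q" "bfs_state x b q s1" and P: "same_outside b s s1"
      "est_ok (insert x (set ws)) s1" "far_ok (insert x (set ws)) s1" "vars s1 16 \<in> T \<inter> A"
      "\<forall>v\<in>T \<inter> A. arrs s1 10 (vars s1 16) \<le> arrs s1 10 v" "t1 \<le> t + 152 * m + 110" by blast
    have same: "vars s1 0 = n" "vars s1 4 = length ws" "vars s1 5 = b" "vars s1 13 = r"
      "vars s1 14 = vars s 14" "vars s1 15 = vars s 15"
      using agr b inp r13 inv by (auto simp: agree_def com_defs input_def greedy_inv_def)
    have qA: "set q = A" "length q = card A" using bfs_order_A[OF x(1) q(1)] by simp_all
    have qt: "vars s1 7 = card A" using q(2) qA by (simp add: bfs_state_def)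
    have qr: "q ! r \<in> A" "arrs s1 9 (b + r) = q ! r" "arrs s1 8 (b + q ! r) = Suc (d x (q ! r))"
      if "r < card A"
    proof -
      show A: "q ! r \<in> A" using that qA by (metis nth_mem)
      show "arrs s1 9 (b + r) = q ! r" using that q(2) qA by (simp add: bfs_state_def)
      show "arrs s1 8 (b + q ! r) = Suc (d x (q ! r))"
        using that q(2) qA A A_less by (simp add: bfs_state_def)
    qed
    have bw: "b + 2 * n + 4 < 2 ^ w" using base_bound b_le by simp
    have word: "Suc 0 < 2 ^ w" "b + r < 2 ^ w" "b + n < 2 ^ w" "Suc (length ws) < 2 ^ w"
      using bw r_bounds(2) len by linarith+
    have word': "b + q ! r < 2 ^ w" if "r < card A"
      using bw A_less[OF qr(1)[OF that]] by linarith
    have "wp w (remember_best ;; Assign 2 (Var 16) ;; Assign 5 (Op Plus (Var 5) (Var 0)) ;;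
        Assign 4 (Op Plus (Var 4) (Const 1))) (\<lambda>s' t'. arrs s' = arrs s1 \<and> vars s' 2 = vars s1 16 \<and>
          vars s' 5 = b + n \<and> vars s' 4 = Suc (length ws) \<and> vars s' 7 = card A \<and>
          vars s' 14 = (if r < card A \<and> vars s 14 < Suc (d x (q ! r)) then Suc (d x (q ! r)) else vars s 14) \<and>
          vars s' 15 = (if r < card A \<and> vars s 14 < Suc (d x (q ! r)) then b else vars s 15) \<and>
          t' \<le> t1 + 20) s1 (t1 + 1)"
      unfolding remember_best_def
      by (rule vc_wp) (use same qt qr word word' in \<open>simp cong: vc_cong\<close>)
    then show "wp w (remember_best ;; Assign 2 (Var 16) ;; Assign 5 (Op Plus (Var 5) (Var 0)) ;;
        Assign 4 (Op Plus (Var 4) (Const 1)))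
      (\<lambda>s' t'. greedy_inv (ws @ [vars s 2]) s' \<and> t' \<le> t + 152 * m + 140) s1 (t1 + 1)"
    proof (rule wp_conseq)
      fix s2 :: state and t2
      assume S: "arrs s2 = arrs s1 \<and> vars s2 2 = vars s1 16 \<and>
          vars s2 5 = b + n \<and> vars s2 4 = Suc (length ws) \<and> vars s2 7 = card A \<and>
          vars s2 14 = (if r < card A \<and> vars s 14 < Suc (d x (q ! r)) then Suc (d x (q ! r)) else vars s 14) \<and>
          vars s2 15 = (if r < card A \<and> vars s 14 < Suc (d x (q ! r)) then b else vars s 15) \<and>
          t2 \<le> t1 + 20"
      have "est_ok (insert x (set ws)) s2" "far_ok (insert x (set ws)) s2"
        using P S by (simp_all add: est_ok_def far_ok_def)
      moreover have "best_ok (ws @ [x]) s2"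
      proof (rule best_ok_snoc[OF x(1) _ q(1)])
        show "best_ok ws s" "set ws \<subseteq> A" using inv by (simp_all add: greedy_inv_def)
      qed (use S q(2) P(1) in \<open>simp_all add: b_def bfs_state_def same_outside_def\<close>)
      moreover have "greedy (ws @ [x])"
        by (rule greedy_snoc[OF _ _ x(1) far]) (use inv in \<open>simp_all add: greedy_inv_def x_def\<close>)
      moreover have "arrs s2 8 z = 0" if "length (ws @ [x]) * n \<le> z" for z
        using that S P(1) inv by (simp add: same_outside_def greedy_inv_def b_def)
      moreover have "arrs s2 8 y = 0 \<longleftrightarrow> y \<notin> A" if "y < n" for y
      proof (cases "ws = []")
        case True
        then show ?thesis using that S q(2) qA by (simp add: b_def bfs_state_def)
      next
        case False
        \<comment> \<open>Later searches start behind the first block and leave the membership test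
          intact.\<close>
        then have "n \<le> b" by (cases ws) (simp_all add: b_def)
        then show ?thesis using that S P(1) inv False by (simp add: same_outside_def greedy_inv_def)
      qed
      ultimately show "greedy_inv (ws @ [vars s 2]) s2 \<and> t2 \<le> t + 152 * m + 140"
        using S P len x inv by (simp add: greedy_inv_def b_def flip: x_def)
    qed
  qed
qed

lemma wp_greedy_phase:
  assumes inv: "greedy_inv [] s" and inp: "input s" and adj: "adj s" and r13: "vars s 13 = r"
  shows "wp w greedy_phase (\<lambda>s' t'. (\<exists>ws. length ws = r \<and> greedy_inv ws s') \<and>
    t' \<le> t + r * (152 * m + 142) + 1) s t"
  unfolding greedy_phase_def
proof (rule wp_While[where g = "[]" and f = "\<lambda>ws. r - length ws" and
    I = "\<lambda>ws s' t'. greedy_inv ws s' \<and> t' \<le> t + length ws * (152 * m + 142)"], goal_cases)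
  case 1
  show ?case using inv by simp
next
  case (2 ws s' t')
  show ?case using word_bounds by simp
next
  case (3 ws s' t')
  have r': "vars s' 13 = r" using r13 agree_vars[OF 3(2), of 13] by (simp add: com_defs)
  then have len: "length ws < r" using 3(1,3) by (auto simp: greedy_inv_def split: if_splits)
  have inp': "input s'" and adj': "adj s'"
    by (rule input_agree[OF 3(2) inp] adj_agree[OF 3(2) adj]; simp add: com_defs)+
  show ?case
  proof (rule wp_conseq[OF wp_greedy_step[OF _ len inp' adj' r']])
    show "greedy_inv ws s'" using 3(1) by simp
    fix s'' t''
    assume "greedy_inv (ws @ [vars s' 2]) s'' \<and> t'' \<le> t' + 1 + 152 * m + 140"
    then show "\<exists>ws'. r - length ws' < r - length ws \<and> greedy_inv ws' s'' \<and>
        t'' + 1 \<le> t + length ws' * (152 * m + 142)"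
      using 3(1) len by (intro exI[of _ "ws @ [vars s' 2]"]) auto
  qed
next
  case (4 ws s' t')
  have "vars s' 13 = r" using r13 agree_vars[OF 4(2), of 13] by (simp add: com_defs)
  then have "length ws = r" using 4(1,3) by (auto simp: greedy_inv_def split: if_splits)
  with 4(1) show ?case by auto
qed

text \<open>The first \<open>r\<close> blocks belong to the centres, so the search from
  \<open>q ! j\<close> uses block \<open>r + j\<close>.\<close>

definition ball_inv :: "nat set \<Rightarrow> nat list \<Rightarrow> nat \<Rightarrow> nat \<Rightarrow> state \<Rightarrow> bool" where
  "ball_inv X q z j s \<longleftrightarrow> vars s 4 = j \<and> j \<le> r \<and> j \<le> card A \<and> vars s 5 = (r + j) * n \<and>
     vars s 7 = card A \<and> vars s 15 = z * n \<and>
     est_ok (X \<union> set (take j q)) s \<and> far_ok (X \<union> set (take j q)) s \<and>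
     (\<forall>i<card A. arrs s 9 (z * n + i) = q ! i) \<and>
     (\<forall>y<n. arrs s 8 y = 0 \<longleftrightarrow> y \<notin> A) \<and> (\<forall>u\<ge>(r + j) * n. arrs s 8 u = 0)"

lemma wp_ball_step:
  assumes inv: "ball_inv X q z j s" and z: "z < r" and q: "set q = A" "length q = card A"
    and j: "j < r" "j < card A" and inp: "input s" and adj: "adj s"
  shows "wp w ball_step (\<lambda>s' t'. ball_inv X q z (Suc j) s' \<and> t' \<le> t + 152 * m + 130) s t"
proof -
  define x where "x = q ! j"
  define b where "b = (r + j) * n"
  have x: "x \<in> A" using q j unfolding x_def by (metis nth_mem)
  have b_le: "b + n \<le> 2 * r * n"
  proof -
    have "b + n = Suc (r + j) * n" by (simp add: b_def)
    also have "\<dots> \<le> 2 * r * n" using j by (intro mult_le_mono1) simp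
    finally show ?thesis .
  qed
  \<comment> \<open>The queue being read lies in a block of the first phase, below the cells written
    now.\<close>
  have zb: "z * n + i < b" if "i < card A" for i
  proof -
    have "z * n + i < Suc z * n" using that card_A by simp
    also have "\<dots> \<le> b" unfolding b_def using z by (intro mult_le_mono1) simp
    finally show ?thesis .
  qed
  have nb: "n \<le> b" using r_bounds(1) unfolding b_def by (cases r) auto
  have bw: "b + 2 * n + 4 < 2 ^ w" using base_bound b_le by simp
  have word: "Suc 0 < 2 ^ w" "z * n + j < 2 ^ w" "b + n < 2 ^ w" "Suc j < 2 ^ w"
    using bw zb[OF j(2)] j card_A by linarith+
  define s0 where "s0 = set_var 2 x s"
  have s0: "vars s0 2 = x" "vars s0 5 = b" "input s0" "adj s0" "arrs s0 = arrs s"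
    "est_ok (X \<union> set (take j q)) s0" "far_ok (X \<union> set (take j q)) s0" "vars s0 4 = j" "vars s0 15 = z * n"
    using inv inp adj
    by (simp_all add: s0_def ball_inv_def b_def input_def adj_def est_ok_def far_ok_def)
  have fresh: "arrs s0 8 (b + y) = 0" for y using inv by (simp add: s0 ball_inv_def b_def)
  have tk: "set (take (Suc j) q) = insert x (set (take j q))"
    using j q by (simp add: take_Suc_conv_app_nth x_def)
  have "wp w (explore ;; Assign 5 (Op Plus (Var 5) (Var 0)) ;; Assign 4 (Op Plus (Var 4) (Const 1)))
    (\<lambda>s' t'. ball_inv X q z (Suc j) s' \<and> t' \<le> t + 152 * m + 130) s0 (t + 2)"
  proof (rule wp_Seq, rule wp_conseq[OF wp_explore[OF s0(1) x s0(2) _ s0(3,4) fresh s0(6,7)]])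
    show "b \<le> 2 * r * n" using b_le by simp
    fix s1 t1
    assume agr: "agree explore s0 s1" and "(\<exists>q. bfs_order R x q \<and> bfs_state x b q s1) \<and>
      same_outside b s0 s1 \<and> est_ok (insert x (X \<union> set (take j q))) s1 \<and>
      far_ok (insert x (X \<union> set (take j q))) s1 \<and>
      vars s1 16 \<in> T \<inter> A \<and> (\<forall>v\<in>T \<inter> A. arrs s1 10 (vars s1 16) \<le> arrs s1 10 v) \<and>
      t1 \<le> t + 2 + 152 * m + 110"
    then obtain q' where q': "bfs_order R x q'" "bfs_state x b q' s1" and P: "same_outside b s0 s1"
      "est_ok (insert x (X \<union> set (take j q))) s1" "far_ok (insert x (X \<union> set (take j q))) s1"
      "t1 \<le> t + 2 + 152 * m + 110" by blast
    have same: "vars s1 0 = n" "vars s1 4 = j" "vars s1 5 = b" "vars s1 15 = z * n"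
      using agr s0 by (auto simp: agree_def com_defs input_def)
    have qt: "vars s1 7 = card A"
      using q' bfs_order_A[OF x q'(1)] by (simp add: bfs_state_def)
    have "ball_inv X q z (Suc j) (set_var 4 (Suc j) (set_var 5 (b + n) s1))"
      unfolding ball_inv_def
    proof (intro conjI allI impI)
      show "est_ok (X \<union> set (take (Suc j) q)) (set_var 4 (Suc j) (set_var 5 (b + n) s1))"
        "far_ok (X \<union> set (take (Suc j) q)) (set_var 4 (Suc j) (set_var 5 (b + n) s1))"
        using P by (simp_all add: tk est_ok_def far_ok_def)
      show "arrs (set_var 4 (Suc j) (set_var 5 (b + n) s1)) 9 (z * n + i) = q ! i" if "i < card A" for i
        using that P(1) zb[OF that] inv by (simp add: same_outside_def s0(5) ball_inv_def)
      show "arrs (set_var 4 (Suc j) (set_var 5 (b + n) s1)) 8 y = 0 \<longleftrightarrow> y \<notin> A" if "y < n" for y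
        using that P(1) nb inv by (simp add: same_outside_def s0(5) ball_inv_def)
      show "arrs (set_var 4 (Suc j) (set_var 5 (b + n) s1)) 8 u = 0" if "(r + Suc j) * n \<le> u" for u
        using that P(1) inv by (simp add: same_outside_def s0(5) ball_inv_def b_def)
    qed (use same qt j in \<open>simp_all add: b_def\<close>)
    then show "wp w (Assign 5 (Op Plus (Var 5) (Var 0)) ;; Assign 4 (Op Plus (Var 4) (Const 1)))
      (\<lambda>s' t'. ball_inv X q z (Suc j) s' \<and> t' \<le> t + 152 * m + 130) s1 (t1 + 1)"
      using same word P(4) by (intro vc_wp) (simp cong: vc_cong)
  qed
  moreover have "arrs s 9 (z * n + j) = x" "vars s 15 = z * n" "vars s 4 = j"
    using inv j by (simp_all add: ball_inv_def x_def)
  ultimately show ?thesis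
    unfolding ball_step_def using word
    by (intro wp_Seq[of w "Assign 2 e" for e] wp_Assign) (simp_all add: s0_def)
qed

lemma wp_ball_phase:
  assumes inv: "ball_inv X q z 0 s" and z: "z < r" and q: "set q = A" "length q = card A"
    and inp: "input s" and adj: "adj s" and r13: "vars s 13 = r"
  shows "wp w ball_phase (\<lambda>s' t'. est_ok (X \<union> set (take r q)) s' \<and>
    (\<forall>y<n. arrs s' 8 y = 0 \<longleftrightarrow> y \<notin> A) \<and> t' \<le> t + r * (152 * m + 132) + 1) s t"
  unfolding ball_phase_def
proof (rule wp_While[where g = 0 and f = "\<lambda>j. r - j" and
    I = "\<lambda>j s' t'. ball_inv X q z j s' \<and> t' \<le> t + j * (152 * m + 132)"], goal_cases)
  case 1
  show ?case using inv by simp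
next
  case (2 j s' t')
  show ?case using word_bounds by simp
next
  case (3 j s' t')
  have r': "vars s' 13 = r" using r13 agree_vars[OF 3(2), of 13] by (simp add: com_defs)
  then have j: "j < r" "j < card A" using 3(1,3) by (auto simp: ball_inv_def split: if_splits)
  have inp': "input s'" and adj': "adj s'"
    by (rule input_agree[OF 3(2) inp] adj_agree[OF 3(2) adj]; simp add: com_defs)+
  show ?case
  proof (rule wp_conseq[OF wp_ball_step[OF _ z q j inp' adj']])
    show "ball_inv X q z j s'" using 3(1) by simp
    fix s'' t''
    assume "ball_inv X q z (Suc j) s'' \<and> t'' \<le> t' + 1 + 152 * m + 130"
    then show "\<exists>j'. r - j' < r - j \<and> ball_inv X q z j' s'' \<and> t'' + 1 \<le> t + j' * (152 * m + 132)"
      using 3(1) j by (intro exI[of _ "Suc j"]) auto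
  qed
next
  case (4 j s' t')
  have "vars s' 13 = r" using r13 agree_vars[OF 4(2), of 13] by (simp add: com_defs)
  then have "j = r \<or> j = card A" "j \<le> r" using 4(1,3) by (auto simp: ball_inv_def split: if_splits)
  \<comment> \<open>A stop before \<open>r\<close> means that the queue, and hence all of
    \<open>A\<close>, has been used up.\<close>
  then have tk: "take j q = take r q" and "j * (152 * m + 132) \<le> r * (152 * m + 132)"
    using q by auto
  then have "t' + 1 \<le> t + r * (152 * m + 132) + 1" using 4(1) by linarith
  with 4(1) show ?case by (simp add: ball_inv_def tk)
qed

text \<open>A ball around \<open>c\<close> with at most \<open>r\<close> elements has a radius below
  the distance of entry \<open>r\<close> in the queue of \<open>c\<close>, hence below the maximum
  of these distances, attained at \<open>ws ! z\<close>. The ball of this radius around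
  \<open>ws ! z\<close> therefore ends before entry \<open>r\<close>. If
  \<open>card A \<le> r\<close>, the first \<open>r\<close> entries are all of
  \<open>A\<close>.\<close>

lemma best_ok_ball:
  assumes best: "best_ok ws s" and ws: "ws \<noteq> []" "set ws \<subseteq> A"
  obtains z q where "z < length ws" "vars s 15 = z * n" "set q = A" "length q = card A"
    "\<forall>j<card A. arrs s 9 (z * n + j) = q ! j"
    "\<forall>c\<in>set ws. \<forall>a. card {y \<in> A. d c y \<le> a} \<le> r \<longrightarrow>
      {y \<in> A. d (ws ! z) y \<le> a} \<subseteq> set (take r q)"
proof -
  from best ws(1) obtain z q where z: "z < length ws" "vars s 15 = z * n" "bfs_order R (ws ! z) q"
    "\<forall>j<length q. arrs s 9 (z * n + j) = q ! j" "r < card A \<longrightarrow> vars s 14 = Suc (d (ws ! z) (q ! r))"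
    and far: "\<forall>c\<in>set ws. \<forall>a. r < card A \<and> card {y \<in> A. d c y \<le> a} \<le> r \<longrightarrow> Suc a < vars s 14"
    unfolding best_ok_def by (auto split: if_splits)
  have zA: "ws ! z \<in> A" using z(1) ws(2) by auto
  note q = bfs_order_A[OF zA z(3)]
  have ball: "{y \<in> A. d (ws ! z) y \<le> a} \<subseteq> set (take r q)"
    if "c \<in> set ws" "card {y \<in> A. d c y \<le> a} \<le> r" for c a
  proof (cases "r < card A")
    case True
    then have "a < d (ws ! z) (q ! r)" using that far z(5) by auto
    then show ?thesis
      using bfs_order_take[OF z(3), of r] True q component_A[OF zA] by auto
  qed (use q in auto)
  show thesis
    by (rule that[OF z(1,2)]) (use q z(4) ball in auto)
qed

lemma estimates_good:
  assumes est: "est_ok (set ws \<union> set (take r q)) s" and ws: "length ws = r" "set ws \<subseteq> T \<inter> A"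
    and greedy: "greedy ws" and z: "z < length ws" and v: "v \<in> A" and t: "t \<in> T \<inter> A"
    and ball: "\<And>c a. c \<in> set ws \<Longrightarrow> card {y \<in> A. d c y \<le> a} \<le> r \<Longrightarrow>
      {y \<in> A. d (ws ! z) y \<le> a} \<subseteq> set (take r q)"
  shows "d v t \<le> 2 * arrs s 4 v + 1"
proof (rule greedy_centres_estimate[OF sym finite_A A_def _ _ v _ _ _ ball])
  show "set ws \<subseteq> A" "ws ! z \<in> set ws" "t \<in> A" using ws z t by auto
  show "card A < length ws * (r + 1)" using r_bounds(3) ws(1) by simp
  show "\<exists>j<i. \<forall>l<i. d (ws ! j) t \<le> d (ws ! l) (ws ! i)" if "i < length ws" "0 < i" for i
    using greedy that t unfolding greedy_def by blast
  show "d c v \<le> arrs s 4 v" if "c \<in> set ws" for c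
    using est that ws(2) v unfolding est_ok_def by blast
  show "d y t \<le> arrs s 4 v + d y v" if "y \<in> set (take r q)" for y
    using est that v t unfolding est_ok_def by blast
qed

end

section \<open>Infinite eccentricities and the complete program\<close>

definition flag_step :: com where
  "flag_step =
     If (Read 3 (Var 4)) (If (Read 8 (Var 4)) Skip (Assign 18 (Const 1))) Skip ;;
     Assign 4 (Op Plus (Var 4) (Const 1))"

text \<open>The sum is a disjunction, array 8 is read in the block of the first search, where
  \<open>0\<close> means outside its component, and the value \<open>n\<close> is decoded as
  infinity.\<close>

definition infinity_step :: com where
  "infinity_step =
     If (Op Plus (Var 18) (Op Equal (Read 8 (Var 4)) (Const 0))) (Write 4 (Var 4) (Var 0)) Skip ;;
     Assign 4 (Op Plus (Var 4) (Const 1))"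

definition finish :: com where
  "finish =
     Assign 18 (Const 0) ;;
     Assign 4 (Const 0) ;;
     While (Op Less (Var 4) (Var 0)) flag_step ;;
     Assign 4 (Const 0) ;;
     While (Op Less (Var 4) (Var 0)) infinity_step"

text \<open>Counting up takes at most \<open>n + 1\<close> rounds, which the linear term of the time
  bound absorbs.\<close>

definition root :: com where
  "root = While (Op Less (Op Times (Var 13) (Var 13)) (Op Plus (Var 0) (Const 1)))
     (Assign 13 (Op Plus (Var 13) (Const 1)))"

definition find_step :: com where
  "find_step =
     If (Read 3 (Var 4)) (Assign 2 (Var 4) ;; Assign 3 (Const 1)) Skip ;;
     Assign 4 (Op Plus (Var 4) (Const 1))"

definition search :: com where
  "search =
     Assign 4 (Const 0) ;;
     build ;;
     root ;;
     Assign 4 (Const 0) ;;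
     greedy_phase ;;
     Assign 4 (Const 0) ;;
     ball_phase ;;
     finish"

text \<open>For empty \<open>T\<close> the initial zeros are already the eccentricities.\<close>

definition algorithm :: com where
  "algorithm = While (Op Less (Var 4) (Var 0)) find_step ;; If (Var 3) search Skip"

context st_instance
begin

definition correct :: "nat \<Rightarrow> nat \<Rightarrow> bool" where
  "correct v k \<longleftrightarrow>
     (if T = {} then k = 0
      else if T \<subseteq> component R v then (\<exists>t\<in>T. k \<le> d v t) \<and> (\<forall>t\<in>T. d v t \<le> 2 * k + 1)
      else k = n)"

lemma correct_empty: "T = {} \<Longrightarrow> correct v k \<longleftrightarrow> k = 0"
  unfolding correct_def by simp

lemma wp_root:
  assumes inp: "input s" and v13: "vars s 13 = 0"
  shows "wp w root (\<lambda>s' t'. n < vars s' 13 * vars s' 13 \<and> (vars s' 13 - 1) * (vars s' 13 - 1) \<le> n \<and>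
    t' \<le> t + 3 * n + 4) s t"
  unfolding root_def
proof (rule wp_While[where g = 0 and f = "\<lambda>k. n + 1 - k" and
    I = "\<lambda>k s' t'. vars s' 13 = k \<and> (k - 1) * (k - 1) \<le> n \<and> k \<le> n + 1 \<and> t' \<le> t + 3 * k"], goal_cases)
  case 1
  show ?case using v13 by simp
next
  case (2 k s' t')
  have "vars s' 0 = n" using agree_vars[OF 2(2), of 0] inp by (simp add: input_def)
  moreover have "k * k < 2 ^ w"
  proof -
    have "k * k \<le> (n + 1) * (n + 1)" using 2(1) by (intro mult_le_mono) simp_all
    then show ?thesis using word_bounds by simp
  qed
  ultimately show ?case using 2(1) word_bounds by simp
next
  case (3 k s' t')
  have "vars s' 0 = n" using agree_vars[OF 3(2), of 0] inp by (simp add: input_def)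
  then have k: "k * k \<le> n" using 3(1,3) by (simp split: if_splits)
  moreover have "k \<le> k * k" by (cases k) auto
  ultimately have kn: "k \<le> n" by linarith
  have word: "Suc 0 < 2 ^ w" "Suc k < 2 ^ w" using word_bounds kn by linarith+
  show ?case
    by (rule wp_Assign) (use 3(1) k kn word in auto)
next
  case (4 k s' t')
  have "vars s' 0 = n" using agree_vars[OF 4(2), of 0] inp by (simp add: input_def)
  then have "n < k * k" using 4(1,3) by (simp split: if_splits)
  with 4(1) show ?case by auto
qed

lemma wp_find:
  assumes inp: "input s" and i: "vars s 4 = 0" "vars s 3 = 0"
  shows "wp w (While (Op Less (Var 4) (Var 0)) find_step) (\<lambda>s' t'.
    (if T = {} then vars s' 3 = 0 else vars s' 3 = 1 \<and> vars s' 2 \<in> T) \<and> t' \<le> t + 12 * n + 1) s t"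
proof (rule wp_While[where g = 0 and f = "\<lambda>j. n - j" and
    I = "\<lambda>j s' t'. vars s' 4 = j \<and> j \<le> n \<and>
      (if T \<inter> {..<j} = {} then vars s' 3 = 0 else vars s' 3 = 1 \<and> vars s' 2 \<in> T) \<and>
      t' \<le> t + 12 * j"], goal_cases)
  case 1
  show ?case using i by simp
next
  case (2 j s' t')
  show ?case using word_bounds by simp
next
  case (3 j s' t')
  have inp': "input s'"
    by (rule input_agree[OF 3(2) inp]) (simp_all add: find_step_def)
  then have j: "j < n" "vars s' 4 = j" "arrs s' 3 j = of_bool (j \<in> T)"
    using 3(1,3) by (auto simp: input_def split: if_splits)
  have word: "Suc 0 < 2 ^ w" "Suc j < 2 ^ w" using word_bounds j by linarith+
  have "wp w find_step (\<lambda>s'' t''. vars s'' 4 = Suc j \<and>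
      (if j \<in> T then vars s'' 3 = 1 \<and> vars s'' 2 = j
       else vars s'' 3 = vars s' 3 \<and> vars s'' 2 = vars s' 2) \<and> t'' \<le> t' + 11) s' (t' + 1)"
    unfolding find_step_def by (rule vc_wp) (use j word in \<open>simp cong: vc_cong\<close>)
  then show ?case
  proof (rule wp_conseq)
    fix s'' t''
    assume *: "vars s'' 4 = Suc j \<and> (if j \<in> T then vars s'' 3 = 1 \<and> vars s'' 2 = j
       else vars s'' 3 = vars s' 3 \<and> vars s'' 2 = vars s' 2) \<and> t'' \<le> t' + 11"
    have "T \<inter> {..<Suc j} = (if j \<in> T then insert j (T \<inter> {..<j}) else T \<inter> {..<j})"
      by (auto simp: less_Suc_eq)
    then show "\<exists>g'. n - g' < n - j \<and> vars s'' 4 = g' \<and> g' \<le> n \<and>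
        (if T \<inter> {..<g'} = {} then vars s'' 3 = 0 else vars s'' 3 = 1 \<and> vars s'' 2 \<in> T) \<and>
        t'' + 1 \<le> t + 12 * g'"
      using * 3(1) j by (intro exI[of _ "Suc j"]) (auto split: if_splits)
  qed
next
  case (4 j s' t')
  have "vars s' 0 = n" using agree_vars[OF 4(2), of 0] inp by (simp add: input_def find_step_def)
  then have "j = n" using 4(1,3) by (auto split: if_splits)
  moreover have "T \<inter> {..<n} = T" using T by blast
  ultimately show ?case using 4(1) by auto
qed

lemma wp_finish:
  assumes inp: "input s" and D: "\<forall>y<n. arrs s 8 y = 0 \<longleftrightarrow> y \<notin> A"
  shows "wp w finish (\<lambda>s' t'. (\<forall>v<n. arrs s' 4 v = (if T \<subseteq> A \<and> v \<in> A then arrs s 4 v else n)) \<and>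
    t' \<le> t + 24 * n + 12) s t"
proof -
  define s1 where "s1 = set_var 4 0 (set_var 18 0 s)"
  have inf: "wp w (While (Op Less (Var 4) (Var 0)) infinity_step) (\<lambda>s' t'.
      (\<forall>v<n. arrs s' 4 v = (if T \<subseteq> A \<and> v \<in> A then arrs s 4 v else n)) \<and> t' \<le> t + 24 * n + 12) s3 t3"
    if s3: "vars s3 0 = n" "vars s3 4 = 0" "vars s3 18 = of_bool (\<not> T \<subseteq> A)" "arrs s3 = arrs s"
      and t3: "t3 \<le> t + 12 * n + 10" for s3 t3
  proof (rule wp_While[where g = 0 and f = "\<lambda>j. n - j" and
      I = "\<lambda>j s' t'. vars s' 4 = j \<and> j \<le> n \<and> t' \<le> t + 12 * n + 10 + 12 * j \<and>
        (\<forall>v. arrs s' 4 v = (if v < j \<and> \<not> (T \<subseteq> A \<and> v \<in> A) then n else arrs s 4 v))"], goal_cases)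
    case 1
    show ?case using s3 t3 by simp
  next
    case (2 j s' t')
    show ?case using word_bounds by simp
  next
    case (3 j s' t')
    have same: "vars s' 0 = n" "vars s' 18 = of_bool (\<not> T \<subseteq> A)" "arrs s' 8 = arrs s 8"
      using s3 agree_vars[OF 3(2), of 0] agree_vars[OF 3(2), of 18] agree_arrs[OF 3(2), of 8]
      by (simp_all add: infinity_step_def)
    have j: "j < n" "vars s' 4 = j" using 3(1,3) same by (auto split: if_splits)
    have Dj: "arrs s 8 j = 0 \<longleftrightarrow> j \<notin> A" using D j(1) by simp
    have word: "Suc 0 < 2 ^ w" "Suc (Suc 0) < 2 ^ w" "Suc j < 2 ^ w" using word_bounds j by linarith+
    have "wp w infinity_step (\<lambda>s'' t''. vars s'' 4 = Suc j \<and>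
        arrs s'' 4 = (arrs s' 4)(j := if \<not> (T \<subseteq> A \<and> j \<in> A) then n else arrs s' 4 j) \<and> t'' \<le> t' + 11)
        s' (t' + 1)"
      unfolding infinity_step_def
      by (rule vc_wp, cases "T \<subseteq> A"; cases "j \<in> A"; simp add: same j Dj word cong: vc_cong)
    then show ?case
    proof (rule wp_conseq)
      fix s'' t''
      assume *: "vars s'' 4 = Suc j \<and>
        arrs s'' 4 = (arrs s' 4)(j := if \<not> (T \<subseteq> A \<and> j \<in> A) then n else arrs s' 4 j) \<and> t'' \<le> t' + 11"
      show "\<exists>g'. n - g' < n - j \<and> vars s'' 4 = g' \<and> g' \<le> n \<and> t'' + 1 \<le> t + 12 * n + 10 + 12 * g' \<and>
          (\<forall>v. arrs s'' 4 v = (if v < g' \<and> \<not> (T \<subseteq> A \<and> v \<in> A) then n else arrs s 4 v))"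
        using * 3(1) j by (intro exI[of _ "Suc j"]) (auto simp: less_Suc_eq)
    qed
  next
    case (4 j s' t')
    have "vars s' 0 = n" using agree_vars[OF 4(2), of 0] s3 by (simp add: infinity_step_def)
    then have "j = n" using 4(1,3) by (auto split: if_splits)
    with 4(1) show ?case by auto
  qed
  have flag: "wp w (While (Op Less (Var 4) (Var 0)) flag_step) (\<lambda>s' t'.
      vc w (Assign 4 (Const 0) ;; While (Op Less (Var 4) (Var 0)) infinity_step) (\<lambda>s' t'.
      (\<forall>v<n. arrs s' 4 v = (if T \<subseteq> A \<and> v \<in> A then arrs s 4 v else n)) \<and> t' \<le> t + 24 * n + 12)
      s' (t' + 1)) s1 t1"
    if t1: "t1 \<le> t + 4" for t1
  proof (rule wp_While[where g = 0 and f = "\<lambda>j. n - j" and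
      I = "\<lambda>j s' t'. vars s' 4 = j \<and> j \<le> n \<and> t' \<le> t + 4 + 12 * j \<and>
        vars s' 18 = of_bool (\<not> T \<inter> {..<j} \<subseteq> A)"], goal_cases)
    case 1
    show ?case using t1 by (simp add: s1_def)
  next
    case (2 j s' t')
    show ?case using word_bounds by simp
  next
    case (3 j s' t')
    have same: "vars s' 0 = n" "arrs s' 8 = arrs s 8" "arrs s' 3 = arrs s 3"
      using agree_vars[OF 3(2), of 0] agree_arrs[OF 3(2), of 8] agree_arrs[OF 3(2), of 3] inp
      by (simp_all add: flag_step_def s1_def input_def)
    have j: "j < n" "vars s' 4 = j" using 3(1,3) same by (auto split: if_splits)
    have Dj: "arrs s 8 j = 0 \<longleftrightarrow> j \<notin> A" "arrs s 3 j = of_bool (j \<in> T)"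
      using D j inp by (simp_all add: input_def)
    have word: "Suc 0 < 2 ^ w" "Suc j < 2 ^ w" using word_bounds j by linarith+
    have "wp w flag_step (\<lambda>s'' t''. vars s'' 4 = Suc j \<and>
        vars s'' 18 = (if j \<in> T \<and> j \<notin> A then 1 else vars s' 18) \<and> t'' \<le> t' + 11) s' (t' + 1)"
      unfolding flag_step_def
      by (rule vc_wp, cases "j \<in> T"; cases "j \<in> A"; simp add: same j Dj word cong: vc_cong)
    then show ?case
    proof (rule wp_conseq)
      fix s'' t''
      assume *: "vars s'' 4 = Suc j \<and> vars s'' 18 = (if j \<in> T \<and> j \<notin> A then 1 else vars s' 18) \<and>
        t'' \<le> t' + 11"
      have "T \<inter> {..<Suc j} \<subseteq> A \<longleftrightarrow> T \<inter> {..<j} \<subseteq> A \<and> (j \<in> T \<longrightarrow> j \<in> A)"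
        by (auto simp: less_Suc_eq)
      then show "\<exists>g'. n - g' < n - j \<and> vars s'' 4 = g' \<and> g' \<le> n \<and> t'' + 1 \<le> t + 4 + 12 * g' \<and>
          vars s'' 18 = of_bool (\<not> T \<inter> {..<g'} \<subseteq> A)"
        using * 3(1) j by (intro exI[of _ "Suc j"]) auto
    qed
  next
    case (4 j s' t')
    have same: "vars s' 0 = n" "arrs s' = arrs s"
      using agree_vars[OF 4(2), of 0] agree_arrs[OF 4(2)] inp
      by (auto simp: flag_step_def s1_def input_def)
    then have "j = n" using 4(1,3) by (auto split: if_splits)
    moreover have "T \<inter> {..<n} = T" using T by blast
    ultimately have "vars s' 18 = of_bool (\<not> T \<subseteq> A)" "t' \<le> t + 4 + 12 * n" using 4(1) by auto
    then show ?case using same word_bounds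
      by (simp add: inf split del: if_split cong: vc_cong wp_cong)
  qed
  show ?thesis
    unfolding finish_def
    by (rule vc_wp) (use flag word_bounds in \<open>simp add: s1_def cong: vc_cong wp_cong\<close>)
qed

end

context st_search
begin

text \<open>Since \<open>t0\<close> lies in \<open>T\<close>, the component of \<open>v\<close>
  contains \<open>T\<close> exactly if \<open>A\<close> contains both \<open>T\<close> and
  \<open>v\<close>. One component thus decides finiteness for every vertex.\<close>

lemma correct_A:
  assumes v: "v < n" and good: "v \<in> A \<Longrightarrow> (\<exists>t\<in>T \<inter> A. k \<le> d v t) \<and> (\<forall>t\<in>T \<inter> A. d v t \<le> 2 * k + 1)"
  shows "correct v (if T \<subseteq> A \<and> v \<in> A then k else n)"
proof (cases "T \<subseteq> A \<and> v \<in> A")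
  case True
  then have "T \<subseteq> component R v" "T \<inter> A = T" using component_A by auto
  with True good t0 show ?thesis by (auto simp: correct_def)
next
  case False
  have "\<not> T \<subseteq> component R v"
  proof
    assume T: "T \<subseteq> component R v"
    then have "v \<in> A" using t0 component_sym[OF sym] unfolding A_def by blast
    with T False show False using component_A by simp
  qed
  then show ?thesis using False t0 by (auto simp: correct_def)
qed

lemma wp_search_balls:
  assumes inv: "greedy_inv ws s" and len: "length ws = r" and inp: "input s" and adj: "adj s"
    and r13: "vars s 13 = r"
  shows "wp w (Assign 4 (Const 0) ;; ball_phase ;; finish) (\<lambda>s' t'. (\<forall>v<n. correct v (arrs s' 4 v)) \<and>
    t' \<le> t + r * (152 * m + 132) + 24 * n + 20) s t"
proof -
  have ws: "ws \<noteq> []" "set ws \<subseteq> A" using inv len r_bounds(1) by (auto simp: greedy_inv_def)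
  have best: "best_ok ws s" using inv by (simp add: greedy_inv_def)
  obtain z q where z: "z < length ws" "vars s 15 = z * n"
    and q: "set q = A" "length q = card A" "\<forall>j<card A. arrs s 9 (z * n + j) = q ! j"
    and ball: "\<forall>c\<in>set ws. \<forall>a. card {y \<in> A. d c y \<le> a} \<le> r \<longrightarrow>
      {y \<in> A. d (ws ! z) y \<le> a} \<subseteq> set (take r q)"
    by (rule best_ok_ball[OF best ws])
  have "z < r" using z len by simp
  define s1 where "s1 = set_var 4 0 s"
  have s1: "input s1" "adj s1" "vars s1 13 = r"
    using inp adj r13 by (simp_all add: s1_def input_def adj_def)
  have inv1: "ball_inv (set ws) q z 0 s1"
    using inv z q(3) len ws by (simp add: ball_inv_def greedy_inv_def s1_def est_ok_def far_ok_def)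
  have "wp w (ball_phase ;; finish) (\<lambda>s' t'. (\<forall>v<n. correct v (arrs s' 4 v)) \<and>
    t' \<le> t + r * (152 * m + 132) + 24 * n + 20) s1 (t + 2)"
  proof (rule wp_Seq, rule wp_conseq[OF wp_ball_phase[OF inv1 \<open>z < r\<close> q(1,2) s1]])
    fix s2 t2
    assume agr: "agree ball_phase s1 s2" and P: "est_ok (set ws \<union> set (take r q)) s2 \<and>
      (\<forall>y<n. arrs s2 8 y = 0 \<longleftrightarrow> y \<notin> A) \<and> t2 \<le> t + 2 + r * (152 * m + 132) + 1"
    have inp2: "input s2"
      by (rule input_agree[OF agr s1(1)]) (simp_all add: ball_phase_def com_defs)
    have "(\<exists>t\<in>T \<inter> A. arrs s2 4 v \<le> d v t) \<and> (\<forall>t\<in>T \<inter> A. d v t \<le> 2 * arrs s2 4 v + 1)" if "v \<in> A" for v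
    proof (intro conjI ballI)
      show "\<exists>t\<in>T \<inter> A. arrs s2 4 v \<le> d v t" using P that by (simp add: est_ok_def)
      fix t assume t: "t \<in> T \<inter> A"
      have est: "est_ok (set ws \<union> set (take r q)) s2" using P by simp
      have "set ws \<subseteq> T \<inter> A" "greedy ws" using inv by (simp_all add: greedy_inv_def)
      from estimates_good[OF est len this z(1) that t ball[rule_format]]
      show "d v t \<le> 2 * arrs s2 4 v + 1" .
    qed
    then have good: "correct v (if T \<subseteq> A \<and> v \<in> A then arrs s2 4 v else n)" if "v < n" for v
      using correct_A[OF that] by blast
    show "wp w finish (\<lambda>s' t'. (\<forall>v<n. correct v (arrs s' 4 v)) \<and>
      t' \<le> t + r * (152 * m + 132) + 24 * n + 20) s2 (t2 + 1)"
      by (rule wp_conseq[OF wp_finish[OF inp2, of A]]) (use P good in auto)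
  qed
  then show ?thesis
    by (intro wp_Seq[of w "Assign 4 (Const 0)"] wp_Assign) (simp_all add: s1_def)
qed

lemma wp_search_greedy:
  assumes inp: "input s" and adj: "adj s" and t: "vars s 2 = t0" and r13: "vars s 13 = r"
    and zero: "vars s 5 = 0" "vars s 14 = 0" "vars s 15 = 0"
      "arrs s 4 = (\<lambda>_. 0)" "arrs s 8 = (\<lambda>_. 0)" "arrs s 10 = (\<lambda>_. 0)"
  shows "wp w (Assign 4 (Const 0) ;; greedy_phase ;; Assign 4 (Const 0) ;; ball_phase ;; finish)
    (\<lambda>s' t'. (\<forall>v<n. correct v (arrs s' 4 v)) \<and> t' \<le> t + r * (304 * m + 274) + 24 * n + 30) s t"
proof -
  define s1 where "s1 = set_var 4 0 s"
  have s1: "input s1" "adj s1" "vars s1 13 = r"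
    using inp adj r13 by (simp_all add: s1_def input_def adj_def)
  have inv: "greedy_inv [] s1"
    using t t0_A zero
    by (auto simp: greedy_inv_def s1_def est_ok_def far_ok_def greedy_def best_ok_def)
  have "wp w (greedy_phase ;; Assign 4 (Const 0) ;; ball_phase ;; finish)
    (\<lambda>s' t'. (\<forall>v<n. correct v (arrs s' 4 v)) \<and> t' \<le> t + r * (304 * m + 274) + 24 * n + 30) s1 (t + 2)"
  proof (rule wp_Seq, rule wp_conseq[OF wp_greedy_phase[OF inv s1]])
    fix s2 t2
    assume agr: "agree greedy_phase s1 s2" and "(\<exists>ws. length ws = r \<and> greedy_inv ws s2) \<and>
      t2 \<le> t + 2 + r * (152 * m + 142) + 1"
    then obtain ws where ws: "length ws = r" "greedy_inv ws s2"
      and t2: "t2 \<le> t + 2 + r * (152 * m + 142) + 1" by blast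
    have s2: "input s2" "adj s2"
      by (rule input_agree[OF agr s1(1)] adj_agree[OF agr s1(2)]; simp add: greedy_phase_def com_defs)+
    have r2: "vars s2 13 = r"
      using agree_vars[OF agr, of 13] s1(3) by (simp add: greedy_phase_def com_defs)
    show "wp w (Assign 4 (Const 0) ;; ball_phase ;; finish) (\<lambda>s' t'. (\<forall>v<n. correct v (arrs s' 4 v)) \<and>
      t' \<le> t + r * (304 * m + 274) + 24 * n + 30) s2 (t2 + 1)"
      by (rule wp_conseq[OF wp_search_balls[OF ws(2,1) s2 r2]])
         (use t2 in \<open>auto simp: add_mult_distrib2\<close>)
  qed
  then show ?thesis
    by (intro wp_Seq[of w "Assign 4 (Const 0)"] wp_Assign) (simp_all add: s1_def)
qed

end

context st_instance
begin

lemma wp_search: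
  assumes inp: "input s" and t0: "vars s 2 \<in> T"
    and zero: "vars s 5 = 0" "vars s 13 = 0" "vars s 14 = 0" "vars s 15 = 0" "arrs s 4 = (\<lambda>_. 0)"
      "arrs s 5 = (\<lambda>_. 0)" "arrs s 8 = (\<lambda>_. 0)" "arrs s 10 = (\<lambda>_. 0)"
  shows "wp w search (\<lambda>s' t'. (\<forall>v<n. correct v (arrs s' 4 v)) \<and>
    (\<exists>r. (r - 1) * (r - 1) \<le> n \<and> t' \<le> t + r * (304 * m + 274) + 25 * m + 27 * n + 50)) s t"
  unfolding search_def
proof (rule wp_Seq, rule wp_Assign)
  define s1 where "s1 = set_var 4 0 s"
  define t0 where "t0 = vars s 2"
  have s1: "input s1" "vars s1 4 = 0" "arrs s1 5 = (\<lambda>_. 0)"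
    using inp zero by (simp_all add: s1_def input_def)
  have "wp w (build ;; root ;; Assign 4 (Const 0) ;; greedy_phase ;; Assign 4 (Const 0) ;; ball_phase ;; finish)
    (\<lambda>s' t'. (\<forall>v<n. correct v (arrs s' 4 v)) \<and>
    (\<exists>r. (r - 1) * (r - 1) \<le> n \<and> t' \<le> t + r * (304 * m + 274) + 25 * m + 27 * n + 50)) s1 (t + 2)"
  proof (rule wp_Seq, rule wp_conseq[OF wp_build[OF s1]], rule wp_Seq)
    fix s2 t2
    assume agr: "agree build s1 s2" and P: "adj s2 \<and> t2 \<le> t + 2 + 25 * m + 1"
    have inp2: "input s2"
      by (rule input_agree[OF agr s1(1)]) (simp_all add: build_def link_edge_def)
    have s2: "vars s2 2 = t0" "vars s2 5 = 0" "vars s2 13 = 0" "vars s2 14 = 0" "vars s2 15 = 0"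
      "arrs s2 4 = (\<lambda>_. 0)" "arrs s2 8 = (\<lambda>_. 0)" "arrs s2 10 = (\<lambda>_. 0)"
      using agr zero by (simp_all add: agree_def build_def link_edge_def s1_def t0_def)
    show "wp w root (\<lambda>s' t'. wp w (Assign 4 (Const 0) ;; greedy_phase ;; Assign 4 (Const 0) ;;
        ball_phase ;; finish) (\<lambda>s' t'. (\<forall>v<n. correct v (arrs s' 4 v)) \<and>
        (\<exists>r. (r - 1) * (r - 1) \<le> n \<and> t' \<le> t + r * (304 * m + 274) + 25 * m + 27 * n + 50))
        s' (t' + 1)) s2 (t2 + 1)"
    proof (rule wp_conseq[OF wp_root[OF inp2 s2(3)]])
      fix s3 t3
      assume agr3: "agree root s2 s3" and Q: "n < vars s3 13 * vars s3 13 \<and>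
        (vars s3 13 - 1) * (vars s3 13 - 1) \<le> n \<and> t3 \<le> t2 + 1 + 3 * n + 4"
      define r where "r = vars s3 13"
      \<comment> \<open>Only here are the parameters known: \<open>t0\<close> and \<open>r\<close>
        are values computed by the program, which is also why \<open>r\<close> is existentially
        quantified in the time bound.\<close>
      interpret st_search n E es T w t0 r
        by unfold_locales (use assms(2) Q in \<open>simp_all add: t0_def r_def\<close>)
      have s3: "input s3" "adj s3"
        by (rule input_agree[OF agr3 inp2] adj_agree[OF agr3]; simp add: root_def P)+
      have s3': "vars s3 2 = t0" "vars s3 13 = r" "vars s3 5 = 0" "vars s3 14 = 0" "vars s3 15 = 0"
        "arrs s3 4 = (\<lambda>_. 0)" "arrs s3 8 = (\<lambda>_. 0)" "arrs s3 10 = (\<lambda>_. 0)"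
        using agr3 s2 by (simp_all add: agree_def root_def r_def)
      show "wp w (Assign 4 (Const 0) ;; greedy_phase ;; Assign 4 (Const 0) ;; ball_phase ;; finish)
        (\<lambda>s' t'. (\<forall>v<n. correct v (arrs s' 4 v)) \<and>
        (\<exists>r. (r - 1) * (r - 1) \<le> n \<and> t' \<le> t + r * (304 * m + 274) + 25 * m + 27 * n + 50))
        s3 (t3 + 1)"
      proof (rule wp_conseq[OF wp_search_greedy[OF s3 s3']])
        fix s4 t4
        assume "(\<forall>v<n. correct v (arrs s4 4 v)) \<and> t4 \<le> t3 + 1 + r * (304 * m + 274) + 24 * n + 30"
        then show "(\<forall>v<n. correct v (arrs s4 4 v)) \<and>
          (\<exists>r. (r - 1) * (r - 1) \<le> n \<and> t4 \<le> t + r * (304 * m + 274) + 25 * m + 27 * n + 50)"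
          using P Q by (intro conjI exI[of _ r]) (auto simp: r_def)
      qed
    qed
  qed
  then show "wp w (build ;; root ;; Assign 4 (Const 0) ;; greedy_phase ;; Assign 4 (Const 0) ;; ball_phase ;; finish)
    (\<lambda>s' t'. (\<forall>v<n. correct v (arrs s' 4 v)) \<and>
    (\<exists>r. (r - 1) * (r - 1) \<le> n \<and> t' \<le> t + r * (304 * m + 274) + 25 * m + 27 * n + 50))
    (set_var 4 (val (Const 0) s) s) (t + 1 + 1)"
    by (simp add: s1_def)
qed simp

lemma wp_algorithm:
  assumes s: "s = input_state n es S T"
  shows "wp w algorithm (\<lambda>s' t'. (\<forall>v<n. correct v (arrs s' 4 v)) \<and>
    (\<exists>r. (r - 1) * (r - 1) \<le> n \<and> t' \<le> r * (304 * m + 274) + 25 * m + 39 * n + 60)) s 0"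
  unfolding algorithm_def
proof (rule wp_Seq)
  have inp: "input s" by (simp add: s input_def input_state_def)
  have zero: "vars s 4 = 0" "vars s 3 = 0" by (simp_all add: s input_state_def)
  show "wp w (While (Op Less (Var 4) (Var 0)) find_step) (\<lambda>s' t'. wp w (If (Var 3) search Skip)
    (\<lambda>s' t'. (\<forall>v<n. correct v (arrs s' 4 v)) \<and>
    (\<exists>r. (r - 1) * (r - 1) \<le> n \<and> t' \<le> r * (304 * m + 274) + 25 * m + 39 * n + 60)) s' (t' + 1)) s 0"
  proof (rule wp_conseq[OF wp_find[OF inp zero]])
    fix s1 t1
    assume agr: "agree (While (Op Less (Var 4) (Var 0)) find_step) s s1" and
      P: "(if T = {} then vars s1 3 = 0 else vars s1 3 = 1 \<and> vars s1 2 \<in> T) \<and> t1 \<le> 0 + 12 * n + 1"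
    have inp1: "input s1"
      by (rule input_agree[OF agr inp]) (simp_all add: find_step_def)
    have s1: "vars s1 5 = 0" "vars s1 13 = 0" "vars s1 14 = 0" "vars s1 15 = 0" "arrs s1 4 = (\<lambda>_. 0)"
      "arrs s1 5 = (\<lambda>_. 0)" "arrs s1 8 = (\<lambda>_. 0)" "arrs s1 10 = (\<lambda>_. 0)"
      using agr by (auto simp: agree_def find_step_def s input_state_def)
    show "wp w (If (Var 3) search Skip) (\<lambda>s' t'. (\<forall>v<n. correct v (arrs s' 4 v)) \<and>
      (\<exists>r. (r - 1) * (r - 1) \<le> n \<and> t' \<le> r * (304 * m + 274) + 25 * m + 39 * n + 60)) s1 (t1 + 1)"
    proof (rule wp_If)
      assume "val (Var 3) s1 \<noteq> 0"
      then have "vars s1 2 \<in> T" using P by (auto split: if_splits)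
      then show "wp w search (\<lambda>s' t'. (\<forall>v<n. correct v (arrs s' 4 v)) \<and>
        (\<exists>r. (r - 1) * (r - 1) \<le> n \<and> t' \<le> r * (304 * m + 274) + 25 * m + 39 * n + 60)) s1 (t1 + 1 + 1)"
      proof (rule wp_conseq[OF wp_search[OF inp1 _ s1]])
        fix s2 t2
        assume "(\<forall>v<n. correct v (arrs s2 4 v)) \<and> (\<exists>r. (r - 1) * (r - 1) \<le> n \<and>
          t2 \<le> t1 + 1 + 1 + r * (304 * m + 274) + 25 * m + 27 * n + 50)"
        then obtain r where "\<forall>v<n. correct v (arrs s2 4 v)" "(r - 1) * (r - 1) \<le> n"
          "t2 \<le> t1 + 1 + 1 + r * (304 * m + 274) + 25 * m + 27 * n + 50" by blast
        moreover from this P have "t2 \<le> r * (304 * m + 274) + 25 * m + 39 * n + 60" by linarith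
        ultimately show "(\<forall>v<n. correct v (arrs s2 4 v)) \<and>
          (\<exists>r. (r - 1) * (r - 1) \<le> n \<and> t2 \<le> r * (304 * m + 274) + 25 * m + 39 * n + 60)" by blast
      qed
    next
      assume "val (Var 3) s1 = 0"
      then have "T = {}" using P by (auto split: if_splits)
      then have "correct v 0" for v by (rule correct_empty[THEN iffD2]) (rule refl)
      moreover have "t1 \<le> 12 * n + 1" using P by simp
      ultimately show "wp w Skip (\<lambda>s' t'. (\<forall>v<n. correct v (arrs s' 4 v)) \<and>
        (\<exists>r. (r - 1) * (r - 1) \<le> n \<and> t' \<le> r * (304 * m + 274) + 25 * m + 39 * n + 60)) s1 (t1 + 1 + 1)"
        \<comment> \<open>The witness \<open>0\<close> is admissible because \<open>0 - 1\<close> is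
          \<open>0\<close> on \<open>nat\<close>.\<close>
        using s1(5) by (intro wp_Skip conjI exI[of _ 0]) simp_all
    qed simp
  qed
qed

section \<open>Extended eccentricities and the final constants\<close>

lemma gdist_R: "gdist E v u = (if u \<in> component R v then enat (d v u) else \<infinity>)"
proof -
  have "R = (\<lambda>x y. {x, y} \<in> E)" by (intro ext) (simp add: R_def)
  then show ?thesis using gdist_eq[of E v u] by simp
qed

lemma correct_ecc:
  assumes v: "v < n" and k: "correct v k"
  shows "(if k < n then enat k else \<infinity>) \<le> ecc E T v"
    and "ecc E T v \<le> 2 * (if k < n then enat k else \<infinity>) + 1"
proof -
  have "(if k < n then enat k else \<infinity>) \<le> ecc E T v \<and>
    ecc E T v \<le> 2 * (if k < n then enat k else \<infinity>) + 1"
  proof (cases "T = {}")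
    case True
    then have "k = 0" using k by (rule correct_empty[THEN iffD1])
    moreover have "ecc E T v = 0" using True by (simp add: ecc_def bot_enat_def)
    ultimately show ?thesis using n by (simp flip: zero_enat_def)
  next
    case T: False
    show ?thesis
    proof (cases "T \<subseteq> component R v")
      case True
      obtain t where t: "t \<in> T" "k \<le> d v t" and upper: "\<And>u. u \<in> T \<Longrightarrow> d v u \<le> 2 * k + 1"
        using k T True unfolding correct_def by auto
      \<comment> \<open>A finite estimate lies below an actual distance and is never mistaken for
        the code of infinity.\<close>
      have "k < n" using t True d_less[OF v] by (meson le_less_trans subsetD)
      moreover have "enat k \<le> ecc E T v"
        unfolding ecc_def by (rule SUP_upper2[OF t(1)]) (use t True in \<open>auto simp: gdist_R\<close>)
      moreover have "ecc E T v \<le> enat (2 * k + 1)"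
        unfolding ecc_def by (rule SUP_least) (use upper True in \<open>auto simp: gdist_R\<close>)
      moreover have "enat (2 * k + 1) = 2 * enat k + 1"
        by (simp add: numeral_eq_enat one_enat_def)
      ultimately show ?thesis by simp
    next
      case False
      then obtain u where "u \<in> T" "u \<notin> component R v" by blast
      then have "u \<in> T" "gdist E v u = \<infinity>" by (simp_all add: gdist_R)
      then have "ecc E T v = \<infinity>"
        unfolding ecc_def by (metis SUP_upper enat_ord_simps(5))
      moreover have "2 * (\<infinity> :: enat) = \<infinity>" by (simp add: numeral_eq_enat)
      ultimately show ?thesis using k T False by (simp add: correct_def)
    qed
  qed
  then show "(if k < n then enat k else \<infinity>) \<le> ecc E T v"
    "ecc E T v \<le> 2 * (if k < n then enat k else \<infinity>) + 1" by blast+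
qed

end

text \<open>The hypothesis gives \<open>e / 2 - 1 / 2 \<le> k\<close>, stronger than both required
  bounds for either parity. If \<open>k\<close> is finite so is \<open>e\<close>, and the claim is
  one about reals.\<close>

lemma enat_estimate:
  fixes e k :: enat
  assumes "k \<le> e" and "e \<le> 2 * k + 1"
  shows "ereal_of_enat e / 2 - 5 / 2 \<le> ereal_of_enat k" and "ereal_of_enat e / 2 - 2 \<le> ereal_of_enat k"
    and "ereal_of_enat k \<le> ereal_of_enat e"
proof -
  show "ereal_of_enat k \<le> ereal_of_enat e" using assms(1) by simp
  have "ereal_of_enat e / 2 - 5 / 2 \<le> ereal_of_enat k \<and> ereal_of_enat e / 2 - 2 \<le> ereal_of_enat k"
  proof (cases k)
    case (enat i)
    have "2 * k + 1 = enat (2 * i + 1)" by (simp add: enat numeral_eq_enat one_enat_def)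
    then obtain j where j: "e = enat j" "j \<le> 2 * i + 1" using assms(2) by (cases e) auto
    then have "real j \<le> 2 * real i + 1" by linarith
    moreover have "ereal a / 2 = ereal (a / 2)" "(5 :: ereal) / 2 = ereal (5 / 2)" "(2 :: ereal) = ereal 2" for a
      by simp_all
    ultimately show ?thesis using j enat by (simp add: field_simps)
  next
    case infinity
    then show ?thesis by simp
  qed
  then show "ereal_of_enat e / 2 - 5 / 2 \<le> ereal_of_enat k" "ereal_of_enat e / 2 - 2 \<le> ereal_of_enat k"
    by blast+
qed

text \<open>Words have at least \<open>4 * log 2 (n + 2)\<close> bits, so they reach
  \<open>(n + 2) ^ 4\<close>; since \<open>n + 2\<close> is at least 3, this is at least
  \<open>9 * (n + 2) ^ 2\<close>.\<close>

lemma word_len_4: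
  assumes "1 \<le> n"
  shows "8 * (n + 2) ^ 2 < 2 ^ word_len 4 n"
proof -
  define l where "l = nat \<lceil>log 2 (real n + 2)\<rceil>"
  have "log 2 (real n + 2) \<le> real l" unfolding l_def by (rule real_nat_ceiling_ge)
  then have "2 powr log 2 (real n + 2) \<le> 2 powr real l" by (rule powr_mono) simp
  then have "real (n + 2) \<le> real (2 ^ l)" by (simp add: powr_realpow)
  then have "n + 2 \<le> 2 ^ l" by (simp only: of_nat_le_iff)
  then have "(n + 2) ^ 4 \<le> (2 ^ l) ^ 4" by (rule power_mono) simp
  moreover have "(2 :: nat) ^ word_len 4 n = (2 ^ l) ^ 4"
    by (simp add: word_len_def l_def mult.commute flip: power_mult)
  moreover have "8 * (n + 2) ^ 2 < (n + 2) ^ 4"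
  proof -
    define x where "x = n + 2"
    have "3 * 3 \<le> x * x" using assms unfolding x_def by (intro mult_le_mono) auto
    then have "9 * x ^ 2 \<le> (x * x) * x ^ 2" by (intro mult_le_mono1) simp
    also have "\<dots> = x ^ 4" by (simp add: power2_eq_square power4_eq_xxxx)
    finally have "9 * (n + 2) ^ 2 \<le> (n + 2) ^ 4" by (simp only: x_def)
    moreover have "0 < (n + 2) ^ 2" by simp
    ultimately show ?thesis by linarith
  qed
  ultimately show ?thesis by linarith
qed

lemma time_bound:
  assumes n: "1 \<le> n" and r: "(r - 1) * (r - 1) \<le> n"
    and t: "t \<le> r * (304 * m + 274) + 25 * m + 39 * n + 60"
  shows "real t \<le> 1000 * (real m * sqrt (real n) + real n)"
proof -
  define q where "q = sqrt (real n)"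
  have q: "1 \<le> q" "q * q = real n" using n by (simp_all add: q_def)
  have "real (r - 1) \<le> q"
    unfolding q_def by (rule real_le_rsqrt) (use r in \<open>simp add: power2_eq_square flip: of_nat_mult\<close>)
  \<comment> \<open>As \<open>q\<close> is at least 1, the extra 1 in \<open>r \<le> q + 1\<close>
    costs a factor of 2. The terms with \<open>m\<close> then total at most
    \<open>633 * m * q\<close>, the others at most \<open>647 * n\<close>.\<close>
  then have r2: "real r \<le> 2 * q" using q by linarith
  have "q \<le> real n" using mult_left_mono[of 1 q q] q by simp
  moreover have "real m \<le> real m * q" using mult_left_mono[of 1 q "real m"] q by simp
  moreover have "real r * (304 * real m + 274) \<le> 2 * q * (304 * real m + 274)"
    using r2 by (intro mult_right_mono) auto
  moreover have "real t \<le> real r * (304 * real m + 274) + 25 * real m + 39 * real n + 60"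
  proof -
    have "real t \<le> real (r * (304 * m + 274) + 25 * m + 39 * n + 60)" using t by (simp only: of_nat_le_iff)
    then show ?thesis by simp
  qed
  moreover have "1 \<le> real n" "0 \<le> real m * q" using n q by auto
  ultimately show ?thesis by (simp add: algebra_simps flip: q_def)
qed

theorem theorem20:
  "\<forall>c::real. c > 0 \<longrightarrow>
    (\<exists>(P::com) (K::nat) (C::real) (k::nat). K \<ge> 2 \<and>
      (\<forall>(n::nat) (E::nat set set) (es::(nat \<times> nat) list) (S::nat set) (T::nat set).
        n \<ge> 1 \<and> simple_graph n E \<and> edge_list E es \<and> S \<subseteq> {..<n} \<and> T \<subseteq> {..<n} \<longrightarrow>
        (\<exists>t::nat.
          real t \<le> C * (real (card E) * sqrt (real n) + real n) * log 2 (real n + 2) ^ k \<and>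
          halts_within (word_len K n) t P (input_state n es S T) \<and>
          measure_pmf.prob (run (word_len K n) t P (input_state n es S T))
            {(q, s). \<forall>v\<in>S.
               (let e = ereal_of_enat (ecc E T v); e' = ereal_of_enat (estimate n s v) in
                 (e / 2 - 5 / 2 \<le> e' \<and> e' \<le> e) \<and>
                 (2 dvd ecc E T v \<longrightarrow> e / 2 - 2 \<le> e' \<and> e' \<le> e))}
            \<ge> 1 - 1 / real n powr c)))"
proof (intro allI impI, rule exI[of _ algorithm], rule exI[of _ 4], rule exI[of _ 1000],
    rule exI[of _ 0], intro conjI allI impI, goal_cases)
  \<comment> \<open>The factor 4 for the word length and the constant 1000 come from the two
    preceding lemmas; the logarithm has exponent 0 because no polylogarithmic loss occurs.\<close>
  case (2 c n E es S T)
  define w where "w = word_len 4 n"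
  interpret st_instance n E es T w
    by unfold_locales (use 2 word_len_4[of n] in \<open>auto simp: w_def\<close>)
  obtain t s where st: "det_steps w algorithm (input_state n es S T) t Skip s"
    "\<forall>v<n. correct v (arrs s 4 v)"
    "\<exists>r. (r - 1) * (r - 1) \<le> n \<and> t \<le> r * (304 * length es + 274) + 25 * length es + 39 * n + 60"
    using wp_algorithm[OF refl, of S] unfolding wp_def by auto
  \<comment> \<open>The output distribution is a point mass, so the good event has probability one,
    whatever \<open>c\<close> is.\<close>
  have run: "run w t algorithm (input_state n es S T) = return_pmf (Skip, s)"
    by (rule det_steps_run[OF st(1)])
  show ?case
  proof (intro exI[of _ t] conjI)
    show "real t \<le> 1000 * (real (card E) * sqrt (real n) + real n) * log 2 (real n + 2) ^ 0"
      using st(3) time_bound[of n _ t "length es"] n by (auto simp flip: m_eq)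
    show "halts_within (word_len 4 n) t algorithm (input_state n es S T)"
      using run by (simp add: halts_within_def w_def)
    have "estimate n s v \<le> ecc E T v" "ecc E T v \<le> 2 * estimate n s v + 1" if "v \<in> S" for v
      using correct_ecc[of v "arrs s 4 v"] st(2) that 2(2) by (auto simp: estimate_def)
    then have "(Skip, s) \<in> {(q, s). \<forall>v\<in>S.
               (let e = ereal_of_enat (ecc E T v); e' = ereal_of_enat (estimate n s v) in
                 (e / 2 - 5 / 2 \<le> e' \<and> e' \<le> e) \<and>
                 (2 dvd ecc E T v \<longrightarrow> e / 2 - 2 \<le> e' \<and> e' \<le> e))}"
      using enat_estimate[of "estimate n s v" "ecc E T v" for v] by (simp add: Let_def)
    then show "1 - 1 / real n powr c \<le> measure_pmf.prob (run (word_len 4 n) t algorithm (input_state n es S T))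
            {(q, s). \<forall>v\<in>S.
               (let e = ereal_of_enat (ecc E T v); e' = ereal_of_enat (estimate n s v) in
                 (e / 2 - 5 / 2 \<le> e' \<and> e' \<le> e) \<and>
                 (2 dvd ecc E T v \<longrightarrow> e / 2 - 2 \<le> e' \<and> e' \<le> e))}"
      using run by (simp add: w_def measure_return_pmf)
  qed
qed simp

end
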